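(* Let $(M,F)$ be a Landsberg surface (a Finsler surface with $\mathcal{J}=0$) with nonflat geodesic spray $S$, and let $(H,S,V,\mathcal{C})$ be its Berwald frame. Let $\mathcal{F}:=H(\mathcal{I})+V(\mathcal{J})$. Then $\mathcal{F}$ is a first integral of the geodesic flow, that is $S(\mathcal{F})=0$, if and only if $(M,F)$ is Riemannian.
   Context: $M$ is a $2$-dimensional smooth manifold, $\mathcal{T}M$ its tangent bundle with the zero section removed, with induced coordinates $(x^i,y^i)$; $J=\frac{\partial}{\partial y^i}\otimes dx^i$ is the almost-tangent structure and $\mathcal{C}=y^i\frac{\partial}{\partial y^i}$ the Liouville vector field. $F:TM\to\mathbb{R}$ is a Finsler function: smooth and positive on $\mathcal{T}M$, zero exactly on the zero section, positively $1$-homogeneous in $y$, with $g_{ij}=\frac12\frac{\partial^2F^2}{\partial y^i\partial y^j}$ of maximal rank on $\mathcal{T}M$. $S=y^i\frac{\partial}{\partial x^i}-2G^i\frac{\partial}{\partial y^i}$ is its geodesic spray, and "horizontal" refers to the image of the projector $h=\frac12(Id+[J,S])$ (Frölicher–Nijenhuis bracket). With $G^i_j=\partial G^i/\partial y^j$, the Jacobi endomorphism is $\Phi=\big(2\frac{\partial G^i}{\partial x^j}-S(G^i_j)-G^i_kG^k_j\big)\frac{\partial}{\partial y^i}\otimes dx^j$; in dimension $2$ one has $\Phi=K(F^2J-F\,d_JF\otimes\mathcal{C})$, where $K\in C^\infty(\mathcal{T}M)$ is the flag curvature; the Ricci scalar is $\rho=KF^2$. $S$ is nonflat: $K$ vanishes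 nowhere on $\mathcal{T}M$. Berwald frame: $H$ is a horizontal vector field on $\mathcal{T}M$ with $[\mathcal{C},H]=H$, $d_JF(H)=0$, $V:=JH$, normalized so that $[S,H]=\rho V$, $[V,S]=H$, $[H,V]=S+\mathcal{I}H+\mathcal{J}V$ with $\mathcal{J}=S(\mathcal{I})$. Here $\mathcal{I}$ is the main (Cartan) scalar and $\mathcal{J}$ the Landsberg scalar. $H,S,V$ annihilate $F$. $(M,F)$ is Riemannian when $F^2$ is a quadratic form in $y$, equivalently $\mathcal{I}=0$; it is Landsbergian when $\mathcal{J}=0$. *)

theory Defs
  imports "HOL-Analysis.Analysis"
begin

section \<open>Smooth maps between normed spaces\<close>

text \<open>Meant for open sets and finite-dimensional domains, where having continuous directional
  derivatives up to order \<open>k\<close> is the same as being of class \<open>C\<^sup>k\<close>.\<close>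

primrec Ck_on :: "nat \<Rightarrow> 'e::real_normed_vector set \<Rightarrow> ('e \<Rightarrow> 'b::real_normed_vector) \<Rightarrow> bool" where
  "Ck_on 0 W f \<longleftrightarrow> continuous_on W f"
| "Ck_on (Suc k) W f \<longleftrightarrow>
     (\<forall>x\<in>W. f differentiable (at x)) \<and> (\<forall>v. Ck_on k W (\<lambda>x. frechet_derivative f (at x) v))"

definition smooth_map_on :: "'e::real_normed_vector set \<Rightarrow> ('e \<Rightarrow> 'b::real_normed_vector) \<Rightarrow> bool" where
  "smooth_map_on W f \<longleftrightarrow> (\<forall>k. Ck_on k W f)"


section \<open>Manifolds, tangent vectors and vector fields\<close>

text \<open>A chart is its domain together with its coordinate map; the values of the coordinate map off
  the domain are irrelevant. An atlas need not be maximal.\<close>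

type_synonym ('p, 'e) chart = "'p set \<times> ('p \<Rightarrow> 'e)"

definition chart_inv :: "('p, 'e) chart \<Rightarrow> 'e \<Rightarrow> 'p" where
  "chart_inv c = inv_into (fst c) (snd c)"

definition local_rep :: "('p, 'e) chart \<Rightarrow> ('p \<Rightarrow> 'b) \<Rightarrow> 'e \<Rightarrow> 'b" where
  "local_rep c f = (\<lambda>z. f (chart_inv c z))"

definition transition :: "('p, 'e) chart \<Rightarrow> ('p, 'e) chart \<Rightarrow> 'e \<Rightarrow> 'e" where
  "transition c c' = local_rep c (snd c')"

definition carrier :: "('p, 'e) chart set \<Rightarrow> 'p set" where
  "carrier B = \<Union> (fst ` B)"

definition smooth_manifold :: "'p topology \<Rightarrow> ('p, 'e::euclidean_space) chart set \<Rightarrow> bool" where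
  "smooth_manifold X A \<longleftrightarrow>
     Hausdorff_space X \<and> second_countable X \<and> topspace X = carrier A \<and>
     (\<forall>c\<in>A. openin X (fst c) \<and> open (snd c ` fst c) \<and>
        homeomorphic_map (subtopology X (fst c)) (top_of_set (snd c ` fst c)) (snd c)) \<and>
     (\<forall>c\<in>A. \<forall>c'\<in>A. smooth_map_on (snd c ` (fst c \<inter> fst c')) (transition c c'))"

text \<open>A tangent vector at \<open>p\<close> is the family of its components in the charts around \<open>p\<close>, subject to
  the transformation law. The components in charts not around \<open>p\<close> are set to \<open>0\<close>, so that
  equality of tangent vectors is equality of functions.\<close>

definition tangent_space :: "('p, 'e::euclidean_space) chart set \<Rightarrow> 'p \<Rightarrow> (('p, 'e) chart \<Rightarrow> 'e) set" where
  "tangent_space B p =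
     {v. (\<forall>c\<in>B. \<forall>c'\<in>B. p \<in> fst c \<inter> fst c' \<longrightarrow>
            v c' = frechet_derivative (transition c c') (at (snd c p)) (v c)) \<and>
         (\<forall>c. \<not> (c \<in> B \<and> p \<in> fst c) \<longrightarrow> v c = 0)}"

definition smooth_function :: "('p, 'e::euclidean_space) chart set \<Rightarrow> ('p \<Rightarrow> real) \<Rightarrow> bool" where
  "smooth_function B f \<longleftrightarrow> (\<forall>c\<in>B. smooth_map_on (snd c ` fst c) (local_rep c f))"

type_synonym ('p, 'e) vfield = "'p \<Rightarrow> ('p, 'e) chart \<Rightarrow> 'e"

definition smooth_vfield :: "('p, 'e::euclidean_space) chart set \<Rightarrow> ('p, 'e) vfield \<Rightarrow> bool" where
  "smooth_vfield B Y \<longleftrightarrow>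
     (\<forall>p\<in>carrier B. Y p \<in> tangent_space B p) \<and>
     (\<forall>c\<in>B. smooth_map_on (snd c ` fst c) (local_rep c (\<lambda>p. Y p c)))"

text \<open>\<open>df\<^sub>p(w)\<close>. By the transformation law for \<open>w \<in> tangent_space B p\<close> the value does not depend
  on which chart around \<open>p\<close> is selected.\<close>

definition differential ::
    "('p, 'e::euclidean_space) chart set \<Rightarrow> ('p \<Rightarrow> real) \<Rightarrow> 'p \<Rightarrow> (('p, 'e) chart \<Rightarrow> 'e) \<Rightarrow> real" where
  "differential B f p w =
     (let c = (SOME c. c \<in> B \<and> p \<in> fst c)
      in frechet_derivative (local_rep c f) (at (snd c p)) (w c))"

definition vf_apply ::
    "('p, 'e::euclidean_space) chart set \<Rightarrow> ('p, 'e) vfield \<Rightarrow> ('p \<Rightarrow> real) \<Rightarrow> 'p \<Rightarrow> real" where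
  "vf_apply B Y f p = differential B f p (Y p)"

definition lie_bracket ::
    "('p, 'e::euclidean_space) chart set \<Rightarrow> ('p, 'e) vfield \<Rightarrow> ('p, 'e) vfield \<Rightarrow> ('p, 'e) vfield" where
  "lie_bracket B Y Z p c =
     (if c \<in> B \<and> p \<in> fst c
      then frechet_derivative (local_rep c (\<lambda>q. Z q c)) (at (snd c p)) (Y p c)
         - frechet_derivative (local_rep c (\<lambda>q. Y q c)) (at (snd c p)) (Z p c)
      else 0)"


section \<open>The tangent bundle of a surface\<close>

type_synonym 'a tvec = "'a \<times> (('a, real^2) chart \<Rightarrow> real^2)"
type_synonym 'a tchart = "('a tvec, (real^2) \<times> (real^2)) chart"
type_synonym 'a tvfield = "('a tvec, (real^2) \<times> (real^2)) vfield"

definition tangent_bundle :: "('a, real^2) chart set \<Rightarrow> 'a tvec set" where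
  "tangent_bundle A = {(p, v). p \<in> carrier A \<and> v \<in> tangent_space A p}"

definition slit_bundle :: "('a, real^2) chart set \<Rightarrow> 'a tvec set" where
  "slit_bundle A = {(p, v) \<in> tangent_bundle A. v \<noteq> (\<lambda>c. 0)}"

text \<open>The induced coordinates \<open>(x, y)\<close>.\<close>

definition induced_chart :: "('a, real^2) chart set \<Rightarrow> ('a, real^2) chart \<Rightarrow> 'a tchart" where
  "induced_chart A c = ({(p, v) \<in> slit_bundle A. p \<in> fst c}, (\<lambda>(p, v). (snd c p, v c)))"

definition slit_atlas :: "('a, real^2) chart set \<Rightarrow> 'a tchart set" where
  "slit_atlas A = induced_chart A ` A"

text \<open>\<open>J = \<partial>/\<partial>y\<^sup>i \<otimes> dx\<^sup>i\<close>.\<close>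

definition almost_tangent ::
    "('a tchart \<Rightarrow> (real^2) \<times> (real^2)) \<Rightarrow> 'a tchart \<Rightarrow> (real^2) \<times> (real^2)" where
  "almost_tangent w = (\<lambda>c. (0, fst (w c)))"

text \<open>\<open>C = y\<^sup>i \<partial>/\<partial>y\<^sup>i\<close>.\<close>

definition liouville :: "('a, real^2) chart set \<Rightarrow> 'a tvfield" where
  "liouville A u = (\<lambda>c. if c \<in> slit_atlas A \<and> u \<in> fst c then (0, snd (snd c u)) else 0)"


section \<open>Finsler functions and their geodesic sprays\<close>

definition fundamental_tensor :: "('a tvec \<Rightarrow> real) \<Rightarrow> 'a tvec \<Rightarrow> 'a tchart \<Rightarrow> real^2^2" where
  "fundamental_tensor F u c =
     (\<chi> i j. 1/2 * frechet_derivative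
        (\<lambda>z. frechet_derivative (local_rep c (\<lambda>w. (F w)\<^sup>2)) (at z) (0, axis j 1))
        (at (snd c u)) (0, axis i 1))"

definition finsler :: "('a, real^2) chart set \<Rightarrow> ('a tvec \<Rightarrow> real) \<Rightarrow> bool" where
  "finsler A F \<longleftrightarrow>
     smooth_function (slit_atlas A) F \<and>
     (\<forall>u\<in>slit_bundle A. F u > 0) \<and>
     (\<forall>p\<in>carrier A. F (p, (\<lambda>c. 0)) = 0) \<and>
     (\<forall>(p, v)\<in>tangent_bundle A. \<forall>t>0. F (p, (\<lambda>c. t *\<^sub>R v c)) = t * F (p, v)) \<and>
     (\<forall>u\<in>slit_bundle A. \<forall>c\<in>slit_atlas A. u \<in> fst c \<longrightarrow> rank (fundamental_tensor F u c) = 2)"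

definition riemannian :: "('a, real^2) chart set \<Rightarrow> ('a tvec \<Rightarrow> real) \<Rightarrow> bool" where
  "riemannian A F \<longleftrightarrow>
     (\<forall>c\<in>A. \<forall>p\<in>fst c. \<exists>b. bilinear b \<and> (\<forall>v\<in>tangent_space A p. (F (p, v))\<^sup>2 = b (v c) (v c)))"

text \<open>The vector field with \<open>J S = C\<close>, i.e. \<open>S = y\<^sup>i \<partial>/\<partial>x\<^sup>i - 2 G\<^sup>i \<partial>/\<partial>y\<^sup>i\<close>, that satisfies the
  Euler-Lagrange equations \<open>S(\<partial>F\<^sup>2/\<partial>y\<^sup>i) = \<partial>F\<^sup>2/\<partial>x\<^sup>i\<close>; the regularity of \<open>g\<close> makes it unique on
  the slit tangent bundle.\<close>

definition geodesic_spray :: "('a, real^2) chart set \<Rightarrow> ('a tvec \<Rightarrow> real) \<Rightarrow> 'a tvfield \<Rightarrow> bool" where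
  "geodesic_spray A F S \<longleftrightarrow>
     smooth_vfield (slit_atlas A) S \<and>
     (\<forall>u\<in>slit_bundle A. almost_tangent (S u) = liouville A u) \<and>
     (\<forall>u\<in>slit_bundle A. \<forall>c\<in>slit_atlas A. u \<in> fst c \<longrightarrow>
        (let L = local_rep c (\<lambda>w. (F w)\<^sup>2) in
         \<forall>i. frechet_derivative (\<lambda>z. frechet_derivative L (at z) (0, axis i 1)) (at (snd c u)) (S u c)
           = frechet_derivative L (at (snd c u)) (axis i 1, 0)))"

text \<open>The action of \<open>h = 1/2 (Id + [J,S])\<close> on vector fields, where the Froelicher-Nijenhuis bracket
  is \<open>[J,S](Y) = [J Y, S] - J [Y, S]\<close>.\<close>

definition horizontal_projector ::
    "('a, real^2) chart set \<Rightarrow> 'a tvfield \<Rightarrow> 'a tvfield \<Rightarrow> 'a tvfield" where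
  "horizontal_projector A S Y u = (\<lambda>c. (1/2) *\<^sub>R
     (Y u c + (lie_bracket (slit_atlas A) (\<lambda>w. almost_tangent (Y w)) S u c
                - almost_tangent (lie_bracket (slit_atlas A) Y S u) c)))"

definition horizontal :: "('a, real^2) chart set \<Rightarrow> 'a tvfield \<Rightarrow> 'a tvfield \<Rightarrow> bool" where
  "horizontal A S H \<longleftrightarrow>
     (\<exists>Y. smooth_vfield (slit_atlas A) Y \<and> (\<forall>u\<in>slit_bundle A. H u = horizontal_projector A S Y u))"


section \<open>Curvature\<close>

definition spray_coeff :: "'a tvfield \<Rightarrow> 'a tchart \<Rightarrow> (real^2) \<times> (real^2) \<Rightarrow> real^2" where
  "spray_coeff S c = local_rep c (\<lambda>u. - (1/2) *\<^sub>R snd (S u c))"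

text \<open>\<open>\<Phi> = (2 \<partial>G\<^sup>i/\<partial>x\<^sup>j - S(G\<^sup>i\<^sub>j) - G\<^sup>i\<^sub>k G\<^sup>k\<^sub>j) \<partial>/\<partial>y\<^sup>i \<otimes> dx\<^sup>j\<close> with \<open>G\<^sup>i\<^sub>j = \<partial>G\<^sup>i/\<partial>y\<^sup>j\<close>; below
  \<open>N z e = (G\<^sup>i\<^sub>j(z) e\<^sup>j)\<^sub>i\<close>.\<close>

definition jacobi_endomorphism ::
    "('a, real^2) chart set \<Rightarrow> 'a tvfield \<Rightarrow> 'a tvec \<Rightarrow>
     ('a tchart \<Rightarrow> (real^2) \<times> (real^2)) \<Rightarrow> 'a tchart \<Rightarrow> (real^2) \<times> (real^2)" where
  "jacobi_endomorphism A S u w = (\<lambda>c.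
     if c \<in> slit_atlas A \<and> u \<in> fst c
     then let G = spray_coeff S c; N = (\<lambda>z e. frechet_derivative G (at z) (0, e));
              z = snd c u; e = fst (w c)
          in (0, 2 *\<^sub>R frechet_derivative G (at z) (e, 0)
                 - frechet_derivative (\<lambda>z'. N z' e) (at z) (S u c)
                 - N z (N z e))
     else 0)"

text \<open>\<open>\<Phi> = K (F\<^sup>2 J - F d\<^sub>JF \<otimes> C)\<close> with \<open>d\<^sub>JF(w) = dF(J w)\<close>. As \<open>F\<^sup>2 J - F d\<^sub>JF \<otimes> C\<close> vanishes
  nowhere on the slit tangent bundle of a surface, this determines \<open>K\<close> there.\<close>

definition flag_curvature ::
    "('a, real^2) chart set \<Rightarrow> ('a tvec \<Rightarrow> real) \<Rightarrow> 'a tvfield \<Rightarrow> ('a tvec \<Rightarrow> real) \<Rightarrow> bool" where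
  "flag_curvature A F S K \<longleftrightarrow>
     smooth_function (slit_atlas A) K \<and>
     (\<forall>u\<in>slit_bundle A. \<forall>w\<in>tangent_space (slit_atlas A) u.
        jacobi_endomorphism A S u w =
          (\<lambda>c. K u *\<^sub>R ((F u)\<^sup>2 *\<^sub>R almost_tangent w c
                 - (F u * differential (slit_atlas A) F u (almost_tangent w)) *\<^sub>R liouville A u c)))"

definition nonflat :: "('a, real^2) chart set \<Rightarrow> ('a tvec \<Rightarrow> real) \<Rightarrow> bool" where
  "nonflat A K \<longleftrightarrow> (\<forall>u\<in>slit_bundle A. K u \<noteq> 0)"


section \<open>The Berwald frame\<close>

text \<open>\<open>I\<close> is the main scalar, \<open>L\<close> the Landsberg scalar and \<open>K F\<^sup>2\<close> the Ricci scalar.\<close>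

definition berwald_frame ::
    "('a, real^2) chart set \<Rightarrow> ('a tvec \<Rightarrow> real) \<Rightarrow> 'a tvfield \<Rightarrow> ('a tvec \<Rightarrow> real) \<Rightarrow>
     'a tvfield \<Rightarrow> 'a tvfield \<Rightarrow> ('a tvec \<Rightarrow> real) \<Rightarrow> ('a tvec \<Rightarrow> real) \<Rightarrow> bool" where
  "berwald_frame A F S K H V I L \<longleftrightarrow>
     (let B = slit_atlas A in
      smooth_vfield B H \<and> horizontal A S H \<and>
      V = (\<lambda>u. almost_tangent (H u)) \<and>
      smooth_function B I \<and> smooth_function B L \<and>
      (\<forall>u\<in>slit_bundle A.
         lie_bracket B (liouville A) H u = H u \<and>
         differential B F u (almost_tangent (H u)) = 0 \<and>
         lie_bracket B S H u = (\<lambda>c. (K u * (F u)\<^sup>2) *\<^sub>R V u c) \<and>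
         lie_bracket B V S u = H u \<and>
         lie_bracket B H V u = (\<lambda>c. S u c + I u *\<^sub>R H u c + L u *\<^sub>R V u c) \<and>
         L u = vf_apply B S I u))"

definition landsberg :: "('a, real^2) chart set \<Rightarrow> ('a tvec \<Rightarrow> real) \<Rightarrow> bool" where
  "landsberg A L \<longleftrightarrow> (\<forall>u\<in>slit_bundle A. L u = 0)"

definition first_integral ::
    "('a, real^2) chart set \<Rightarrow> 'a tvfield \<Rightarrow> ('a tvec \<Rightarrow> real) \<Rightarrow> bool" where
  "first_integral A S f \<longleftrightarrow> (\<forall>u\<in>slit_bundle A. vf_apply (slit_atlas A) S f u = 0)"

end

theory Submission
  imports Defs
begin

text \<open>Write \<open>\<phi> = H(I) + V(L)\<close>. On a Landsberg surface \<open>L = S(I)\<close> vanishes identically, so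
  \<open>\<phi> = H(I)\<close>, and the structure equation for \<open>[S, H]\<close> gives
  \<open>S(\<phi>) = [S, H](I) + H(S(I)) = K F\<^sup>2 V(I)\<close> (\<open>flow_derivative_of_H_main_scalar\<close>). Since \<open>K F\<^sup>2\<close> has no
  zeros, \<open>\<phi>\<close> is a first integral exactly when \<open>V(I) = 0\<close>. It remains to compare \<open>V(I) = 0\<close>,
  \<open>I = 0\<close> and the Riemannian condition, and this is done in one punctured tangent plane at a time.

  Let \<open>v\<close> be the vector field on such a plane that represents \<open>V\<close>, which is also the base component
  of \<open>H\<close>, and let \<open>y\<close> be the position vector. The base components of the equations for \<open>[C, H]\<close> and
  \<open>[H, V]\<close> say \<open>C(v) = v\<close> and \<open>V(v) = -y - I v\<close>; moreover \<open>V(F) = 0\<close>. These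
  equations (\<open>berwald_frame_restricts_to_fibre\<close>) give three facts.

  \<^item> The signed area \<open>D = det(y, v)\<close> has no zeros and \<open>V(D) = -I D\<close>. If \<open>V(I) = 0\<close>, then
    \<open>V(I D) = -I\<^sup>2 D\<close>. An indicatrix \<open>F = r\<close> is compact and \<open>V\<close> is tangent to it, so \<open>I D\<close> attains its
    maximum and its minimum there at points where \<open>I\<^sup>2 D = 0\<close>, hence where \<open>I D = 0\<close>. Therefore
    \<open>I = 0\<close> (\<open>main_scalar_zero_if_invariant\<close>). This is where it matters that \<open>F\<close> is defined and
    smooth in every direction of the fibre.

  \<^item> If \<open>I = 0\<close>, then the form for which \<open>(y, v)\<close> is an orthogonal frame with both vectors of length
    \<open>F\<close> has coefficients that are constant along \<open>y\<close> and \<open>v\<close>, so it is one quadratic form on the whole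
    plane; its value at \<open>y\<close> is \<open>F\<^sup>2\<close> (\<open>quadratic_if_main_scalar_zero\<close>).

  \<^item> If \<open>F\<^sup>2\<close> is a quadratic form, then differentiating it repeatedly along \<open>V\<close> shows that \<open>v\<close> is orthogonal
    to \<open>y\<close>, then that \<open>v\<close> has length \<open>F\<close>, and then that \<open>I F\<^sup>2 = 0\<close>
    (\<open>main_scalar_zero_if_quadratic\<close>).

  The identity \<open>[S, H](I) = S(H(I)) - H(S(I))\<close> is proved in charts (\<open>vf_apply_lie_bracket\<close>), from the
  symmetry of second derivatives and the independence of \<open>dI\<close> from the chart.\<close>

section \<open>Differential calculus\<close>

lemma frechet_derivative_cong_open:
  assumes "open W" "z \<in> W" "\<And>x. x \<in> W \<Longrightarrow> f x = g x"
  shows "frechet_derivative f (at z) = frechet_derivative g (at z)"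
proof -
  have "(f has_derivative D) (at z) \<longleftrightarrow> (g has_derivative D) (at z)" for D
    using has_derivative_transform_within_open[OF _ assms(1,2)] assms(3) by metis
  then show ?thesis
    unfolding frechet_derivative_def by simp
qed

lemma smooth_map_on_differentiable:
  assumes "smooth_map_on W f" "z \<in> W"
  shows "f differentiable (at z)"
  using assms Ck_on.simps(2)[of 0 W f] by (simp add: smooth_map_on_def)

lemma smooth_map_on_derivative:
  assumes "smooth_map_on W f"
  shows "smooth_map_on W (\<lambda>x. frechet_derivative f (at x) w)"
  using assms Ck_on.simps(2)[of _ W f] by (auto simp: smooth_map_on_def)

text \<open>The mean value theorem in the direction \<open>v\<close> turns the second difference into \<open>t\<close> times an increment of
  the directional derivative \<open>f' v\<close> over \<open>t w\<close>, which differentiability of \<open>f' v\<close> at the single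
  point \<open>z\<close> evaluates to first order. Both sample points lie within \<open>t (norm v + norm w)\<close> of \<open>z\<close>.\<close>

lemma second_difference_bound:
  fixes f :: "'e::real_normed_vector \<Rightarrow> real"
  assumes W: "open W" "z \<in> W"
    and f: "\<And>x. x \<in> W \<Longrightarrow> (f has_derivative f' x) (at x)"
    and p: "((\<lambda>x. f' x v) has_derivative p') (at z)"
    and e: "e > 0"
  shows "\<exists>d>0. \<forall>t. 0 < t \<and> t < d \<longrightarrow>
    \<bar>f (z + t *\<^sub>R v + t *\<^sub>R w) - f (z + t *\<^sub>R v) - f (z + t *\<^sub>R w) + f z - t\<^sup>2 * p' w\<bar> \<le> e * t\<^sup>2"
proof -
  define N where "N = norm v + norm w + 1"
  have N: "N > 0" by (simp add: N_def add_nonneg_pos)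
  \<comment> \<open>The factor 2 accounts for the two error terms, one for each end of the increment \<open>t w\<close>.\<close>
  define e' where "e' = e / (2 * N)"
  have e': "e' > 0" using e N by (simp add: e'_def)
  have lin: "bounded_linear p'" using p by (rule has_derivative_bounded_linear)
  obtain d1 where d1: "d1 > 0"
    and d1': "\<And>x. norm (x - z) < d1 \<Longrightarrow> norm (f' x v - f' z v - p' (x - z)) \<le> e' * norm (x - z)"
    using p e' unfolding has_derivative_at_alt by blast
  obtain d2 where d2: "d2 > 0" "ball z d2 \<subseteq> W"
    using W by (meson openE)
  define d where "d = min d1 d2 / N"
  have "d > 0" using d1 d2 N by (simp add: d_def)
  moreover
  have "\<bar>f (z + t *\<^sub>R v + t *\<^sub>R w) - f (z + t *\<^sub>R v) - f (z + t *\<^sub>R w) + f z - t\<^sup>2 * p' w\<bar> \<le> e * t\<^sup>2"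
    if t: "0 < t" "t < d" for t
  proof -
    have tN: "t * N < min d1 d2"
      using t N by (simp add: d_def pos_less_divide_eq)
    have small: "norm (s *\<^sub>R v + r *\<^sub>R w) \<le> t * N" if "0 \<le> s" "s \<le> t" "0 \<le> r" "r \<le> t" for s r
    proof -
      have "norm (s *\<^sub>R v + r *\<^sub>R w) \<le> s * norm v + r * norm w"
        using norm_triangle_ineq[of "s *\<^sub>R v" "r *\<^sub>R w"] that by simp
      also have "\<dots> \<le> t * norm v + t * norm w"
        using that by (intro add_mono mult_right_mono) auto
      also have "\<dots> \<le> t * N" using t by (simp add: N_def algebra_simps)
      finally show ?thesis .
    qed
    have inW: "z + s *\<^sub>R v + r *\<^sub>R w \<in> W" if "0 \<le> s" "s \<le> t" "0 \<le> r" "r \<le> t" for s r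
    proof -
      have "z - (z + s *\<^sub>R v + r *\<^sub>R w) = - (s *\<^sub>R v + r *\<^sub>R w)"
        by (simp only: diff_diff_eq[symmetric] diff_self minus_add_distrib) simp
      then have "dist z (z + s *\<^sub>R v + r *\<^sub>R w) = norm (s *\<^sub>R v + r *\<^sub>R w)"
        by (simp only: dist_norm norm_minus_cancel)
      also have "\<dots> < d2" using small[OF that] tN by linarith
      finally show ?thesis using d2(2) by (meson mem_ball subsetD)
    qed
    define g where "g s = f (z + s *\<^sub>R v + t *\<^sub>R w) - f (z + s *\<^sub>R v)" for s
    have "(g has_derivative (\<lambda>h. f' (z + s *\<^sub>R v + t *\<^sub>R w) (h *\<^sub>R v) - f' (z + s *\<^sub>R v) (h *\<^sub>R v)))
            (at s within {0..t})" if "0 \<le> s" "s \<le> t" for s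
    proof -
      have a: "(f has_derivative f' (z + s *\<^sub>R v + t *\<^sub>R w)) (at (z + s *\<^sub>R v + t *\<^sub>R w))"
        using f[OF inW[of s t]] that t by simp
      have b: "(f has_derivative f' (z + s *\<^sub>R v)) (at (z + s *\<^sub>R v))"
        using f[OF inW[of s 0]] that t by simp
      have a': "((\<lambda>s. f (z + s *\<^sub>R v + t *\<^sub>R w)) has_derivative
          (\<lambda>h. f' (z + s *\<^sub>R v + t *\<^sub>R w) (h *\<^sub>R v))) (at s within {0..t})"
        by (rule has_derivative_compose[where f = "\<lambda>s. z + s *\<^sub>R v + t *\<^sub>R w" and g = f, OF _ a])
          (auto intro!: derivative_eq_intros)
      have b': "((\<lambda>s. f (z + s *\<^sub>R v)) has_derivative
          (\<lambda>h. f' (z + s *\<^sub>R v) (h *\<^sub>R v))) (at s within {0..t})"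
        by (rule has_derivative_compose[where f = "\<lambda>s. z + s *\<^sub>R v" and g = f, OF _ b])
          (auto intro!: derivative_eq_intros)
      show ?thesis
        unfolding g_def by (rule has_derivative_diff[OF a' b'])
    qed
    then obtain \<xi> where \<xi>: "0 < \<xi>" "\<xi> < t"
      and "g t - g 0 = f' (z + \<xi> *\<^sub>R v + t *\<^sub>R w) (t *\<^sub>R v) - f' (z + \<xi> *\<^sub>R v) (t *\<^sub>R v)"
      using mvt_simple[OF t(1), of g
          "\<lambda>s h. f' (z + s *\<^sub>R v + t *\<^sub>R w) (h *\<^sub>R v) - f' (z + s *\<^sub>R v) (h *\<^sub>R v)"] by auto
    moreover have "f' x (t *\<^sub>R v) = t * f' x v" if "x \<in> W" for x
      using has_derivative_linear[OF f[OF that]] by (simp add: linear_cmul)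
    ultimately have g: "g t - g 0 = t * (f' (z + \<xi> *\<^sub>R v + t *\<^sub>R w) v - f' (z + \<xi> *\<^sub>R v) v)"
      using inW[of \<xi> t] inW[of \<xi> 0] t by (simp add: algebra_simps)
    have near: "norm (f' (z + \<xi> *\<^sub>R v + r *\<^sub>R w) v - f' z v - p' (\<xi> *\<^sub>R v + r *\<^sub>R w)) \<le> e' * (t * N)"
      if "0 \<le> r" "r \<le> t" for r
    proof -
      have le: "norm (\<xi> *\<^sub>R v + r *\<^sub>R w) \<le> t * N" using small[of \<xi> r] \<xi> that by simp
      have "norm (f' (z + \<xi> *\<^sub>R v + r *\<^sub>R w) v - f' z v - p' (\<xi> *\<^sub>R v + r *\<^sub>R w))
            \<le> e' * norm (\<xi> *\<^sub>R v + r *\<^sub>R w)"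
        using d1'[of "z + \<xi> *\<^sub>R v + r *\<^sub>R w"] le tN by (simp add: add.assoc)
      also have "\<dots> \<le> e' * (t * N)" using le e' by simp
      finally show ?thesis .
    qed
    have p'w: "p' (\<xi> *\<^sub>R v + t *\<^sub>R w) - p' (\<xi> *\<^sub>R v + 0 *\<^sub>R w) = t * p' w"
      using lin by (simp add: linear_simps)
    have "\<bar>(f' (z + \<xi> *\<^sub>R v + t *\<^sub>R w) v - f' (z + \<xi> *\<^sub>R v) v) - t * p' w\<bar> \<le> 2 * (e' * (t * N))"
      using near[of t] near[of 0] t p'w by auto
    also have "\<dots> = e * t" using N by (simp add: e'_def)
    finally have "\<bar>t * ((f' (z + \<xi> *\<^sub>R v + t *\<^sub>R w) v - f' (z + \<xi> *\<^sub>R v) v) - t * p' w)\<bar> \<le> t * (e * t)"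
      using t by (simp add: abs_mult)
    moreover have "f (z + t *\<^sub>R v + t *\<^sub>R w) - f (z + t *\<^sub>R v) - f (z + t *\<^sub>R w) + f z = g t - g 0"
      by (simp add: g_def)
    ultimately show ?thesis
      unfolding g by (simp add: power2_eq_square algebra_simps)
  qed
  ultimately show ?thesis by blast
qed

text \<open>The second difference is symmetric in \<open>v\<close> and \<open>w\<close>, and both mixed derivatives are its limit
  after division by \<open>t\<^sup>2\<close>.\<close>

lemma second_derivative_symmetric:
  fixes f :: "'e::real_normed_vector \<Rightarrow> real"
  assumes W: "open W" "z \<in> W"
    and f: "\<And>x. x \<in> W \<Longrightarrow> (f has_derivative f' x) (at x)"
    and p: "((\<lambda>x. f' x v) has_derivative p') (at z)"
    and q: "((\<lambda>x. f' x w) has_derivative q') (at z)"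
  shows "p' w = q' v"
proof (rule ccontr)
  assume ne: "p' w \<noteq> q' v"
  define e where "e = \<bar>p' w - q' v\<bar> / 3"
  have e: "e > 0" using ne by (simp add: e_def)
  let ?D = "\<lambda>t v w. f (z + t *\<^sub>R v + t *\<^sub>R w) - f (z + t *\<^sub>R v) - f (z + t *\<^sub>R w) + f z"
  obtain d1 where d1: "d1 > 0" "\<And>t. 0 < t \<and> t < d1 \<Longrightarrow> \<bar>?D t v w - t\<^sup>2 * p' w\<bar> \<le> e * t\<^sup>2"
    using second_difference_bound[OF W f p e] by blast
  obtain d2 where d2: "d2 > 0" "\<And>t. 0 < t \<and> t < d2 \<Longrightarrow> \<bar>?D t w v - t\<^sup>2 * q' v\<bar> \<le> e * t\<^sup>2"
    using second_difference_bound[OF W f q e] by blast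
  define t where "t = min d1 d2 / 2"
  have t: "0 < t" "t < d1" "t < d2" using d1 d2 by (auto simp: t_def min_def)
  have "?D t w v = ?D t v w" by (simp add: algebra_simps)
  then have "\<bar>t\<^sup>2 * p' w - t\<^sup>2 * q' v\<bar> \<le> 2 * (e * t\<^sup>2)"
    using d1(2)[of t] d2(2)[of t] t by auto
  moreover have "\<bar>t\<^sup>2 * p' w - t\<^sup>2 * q' v\<bar> = t\<^sup>2 * (3 * e)"
    by (simp add: e_def abs_mult flip: right_diff_distrib)
  ultimately show False using t e by (simp add: algebra_simps)
qed

text \<open>The product rule for \<open>Df(k(q)) h(q)\<close>. The base point \<open>k\<close> is kept separate from the direction \<open>h\<close>
  because two instances are needed: \<open>k\<close> the identity for derivatives along vector fields, and
  \<open>k = fst\<close>, \<open>h = snd\<close> for the induced coordinate changes \<open>(x, y) \<mapsto> (\<tau>(x), D\<tau>(x) y)\<close> of the tangent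
  bundle. Expanding \<open>h\<close> in a basis reduces the claim to derivatives in constant directions.\<close>

lemma has_derivative_directional_derivative:
  fixes f :: "'e::euclidean_space \<Rightarrow> 'b::real_normed_vector" and q :: "'q::real_normed_vector"
  assumes W: "open W" and f: "smooth_map_on W f"
    and U: "open U" "q \<in> U" "k ` U \<subseteq> W"
    and k: "(k has_derivative k') (at q)" and h: "(h has_derivative h') (at q)"
  defines "D \<equiv> \<lambda>x. frechet_derivative f (at x)"
  shows "((\<lambda>q. D (k q) (h q)) has_derivative
     (\<lambda>w. frechet_derivative (\<lambda>x. D x (h q)) (at (k q)) (k' w) + D (k q) (h' w))) (at q)"
proof -
  have kq: "k q \<in> W" using U by auto
  have fd: "(f has_derivative D x) (at x)" if "x \<in> W" for x
    unfolding D_def using smooth_map_on_differentiable[OF f that] by (simp flip: frechet_derivative_works)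
  have Dd: "((\<lambda>x. D x w) has_derivative frechet_derivative (\<lambda>x. D x w) (at (k q))) (at (k q))" for w
    unfolding D_def using smooth_map_on_differentiable[OF smooth_map_on_derivative[OF f] kq]
    by (simp flip: frechet_derivative_works)
  have expand: "D x w = (\<Sum>b\<in>Basis. (w \<bullet> b) *\<^sub>R D x b)" if "x \<in> W" for x w
  proof -
    interpret linear "D x" using has_derivative_linear[OF fd[OF that]] .
    have "D x w = D x (\<Sum>b\<in>Basis. (w \<bullet> b) *\<^sub>R b)" by (simp add: euclidean_representation)
    then show ?thesis by (simp add: sum scale)
  qed
  have "((\<lambda>x. \<Sum>b\<in>Basis. (h q \<bullet> b) *\<^sub>R D x b) has_derivative
      (\<lambda>w. \<Sum>b\<in>Basis. (h q \<bullet> b) *\<^sub>R frechet_derivative (\<lambda>x. D x b) (at (k q)) w)) (at (k q))"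
    by (intro has_derivative_sum has_derivative_scaleR_right Dd)
  then have "((\<lambda>x. D x (h q)) has_derivative
      (\<lambda>w. \<Sum>b\<in>Basis. (h q \<bullet> b) *\<^sub>R frechet_derivative (\<lambda>x. D x b) (at (k q)) w)) (at (k q))"
    by (rule has_derivative_transform_within_open[OF _ W kq]) (rule expand[symmetric])
  then have "frechet_derivative (\<lambda>x. D x (h q)) (at (k q)) =
      (\<lambda>w. \<Sum>b\<in>Basis. (h q \<bullet> b) *\<^sub>R frechet_derivative (\<lambda>x. D x b) (at (k q)) w)"
    by (rule frechet_derivative_at[symmetric])
  moreover have "((\<lambda>q. \<Sum>b\<in>Basis. (h q \<bullet> b) *\<^sub>R D (k q) b) has_derivative
      (\<lambda>w. \<Sum>b\<in>Basis. (h q \<bullet> b) *\<^sub>R frechet_derivative (\<lambda>x. D x b) (at (k q)) (k' w)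
            + (h' w \<bullet> b) *\<^sub>R D (k q) b)) (at q)"
    by (intro has_derivative_sum has_derivative_scaleR has_derivative_inner_left h
        has_derivative_compose[OF k Dd])
  ultimately have "((\<lambda>q. \<Sum>b\<in>Basis. (h q \<bullet> b) *\<^sub>R D (k q) b) has_derivative
     (\<lambda>w. frechet_derivative (\<lambda>x. D x (h q)) (at (k q)) (k' w) + D (k q) (h' w))) (at q)"
    by (simp add: sum.distrib expand[OF kq, of "h' _"])
  then show ?thesis
    by (rule has_derivative_transform_within_open[OF _ U(1,2)]) (use U(3) expand in auto)
qed

text \<open>In \<open>g(h(f)) - h(g(f))\<close> the terms with second derivatives of \<open>f\<close> cancel by symmetry.\<close>

lemma commutator_of_directional_derivatives:
  fixes f :: "'e::euclidean_space \<Rightarrow> real"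
  assumes W: "open W" "z \<in> W"
    and f: "smooth_map_on W f"
    and g: "g differentiable (at z)" and h: "h differentiable (at z)"
  defines "D \<equiv> \<lambda>x. frechet_derivative f (at x)"
  shows "frechet_derivative (\<lambda>x. D x (h x)) (at z) (g z) - frechet_derivative (\<lambda>x. D x (g x)) (at z) (h z)
       = D z (frechet_derivative h (at z) (g z) - frechet_derivative g (at z) (h z))"
proof -
  have fd: "(f has_derivative D x) (at x)" if "x \<in> W" for x
    unfolding D_def using smooth_map_on_differentiable[OF f that] by (simp flip: frechet_derivative_works)
  have Dd: "((\<lambda>x. D x w) has_derivative frechet_derivative (\<lambda>x. D x w) (at z)) (at z)" for w
    unfolding D_def using smooth_map_on_differentiable[OF smooth_map_on_derivative[OF f] W(2)]
    by (simp flip: frechet_derivative_works)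
  have sym: "frechet_derivative (\<lambda>x. D x (h z)) (at z) (g z) = frechet_derivative (\<lambda>x. D x (g z)) (at z) (h z)"
    by (rule second_derivative_symmetric[OF W fd Dd Dd])
  have product_rule: "frechet_derivative (\<lambda>x. D x (k x)) (at z) =
      (\<lambda>w. frechet_derivative (\<lambda>x. D x (k z)) (at z) w + D z (frechet_derivative k (at z) w))"
    if "k differentiable (at z)" for k
    unfolding D_def using that
    by (intro frechet_derivative_at[OF has_derivative_directional_derivative[OF W(1) f W], symmetric])
      (auto simp flip: frechet_derivative_works)
  have lin: "linear (D z)" using has_derivative_linear[OF fd[OF W(2)]] .
  show ?thesis
    unfolding product_rule[OF g] product_rule[OF h] linear_diff[OF lin] sym by simp
qed

text \<open>A level set of \<open>F\<close> meets every ray once, so the normalization \<open>n(y) = (r / F(y)) y\<close> retracts the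
  punctured space onto \<open>F = r\<close>, and \<open>f \<circ> n\<close> is constant along rays. It attains a maximum on the unit
  sphere, which is then a maximum over the open punctured space. This turns the constrained problem
  into an unconstrained one: the derivative of \<open>f \<circ> n\<close> vanishes at the corresponding
  point of the level set, where it agrees with the derivative of \<open>f\<close> on vectors tangent to the level set.\<close>

lemma constrained_maximum:
  fixes F f :: "'e::euclidean_space \<Rightarrow> real"
  assumes pos: "\<And>y. y \<noteq> 0 \<Longrightarrow> F y > 0"
    and hom: "\<And>y t. y \<noteq> 0 \<Longrightarrow> t > 0 \<Longrightarrow> F (t *\<^sub>R y) = t * F y"
    and F: "\<And>y. y \<noteq> 0 \<Longrightarrow> (F has_derivative F' y) (at y)"
    and f: "\<And>y. y \<noteq> 0 \<Longrightarrow> (f has_derivative f' y) (at y)"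
    and r: "r > 0"
  obtains s where "s \<noteq> 0" "F s = r" "\<And>y. y \<noteq> 0 \<Longrightarrow> F y = r \<Longrightarrow> f y \<le> f s"
    "\<And>w. F' s w = 0 \<Longrightarrow> f' s w = 0"
proof -
  define n where "n y = (r / F y) *\<^sub>R y" for y
  have n0: "n y \<noteq> 0" if "y \<noteq> 0" for y using pos[OF that] r that by (simp add: n_def)
  have Fn: "F (n y) = r" if "y \<noteq> 0" for y
    using hom[OF that, of "r / F y"] pos[OF that] r by (simp add: n_def)
  have nn: "n (t *\<^sub>R y) = n y" if "y \<noteq> 0" "t > 0" for t y
    using hom[OF that] pos[OF that(1)] that by (simp add: n_def)
  have n_fix: "n y = y" if "y \<noteq> 0" "F y = r" for y using that r by (simp add: n_def)
  have dn: "(n has_derivative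
      (\<lambda>w. (r / F y) *\<^sub>R w - (r * F' y w / (F y)\<^sup>2) *\<^sub>R y)) (at y)" if "y \<noteq> 0" for y
    unfolding n_def using pos[OF that]
    by (auto intro!: derivative_eq_intros F[OF that] simp: power2_eq_square field_simps)
  define g where "g y = f (n y)" for y
  have dg: "(g has_derivative
      (\<lambda>w. f' (n y) ((r / F y) *\<^sub>R w - (r * F' y w / (F y)\<^sup>2) *\<^sub>R y))) (at y)" if "y \<noteq> 0" for y
    unfolding g_def by (rule has_derivative_compose[OF dn[OF that] f[OF n0[OF that]]])
  have "continuous_on (sphere 0 1) g"
    by (rule has_derivative_continuous_on[where f' = "\<lambda>y w. f' (n y) ((r / F y) *\<^sub>R w - (r * F' y w / (F y)\<^sup>2) *\<^sub>R y)"])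
      (auto intro!: has_derivative_at_withinI[OF dg])
  then obtain s0 where s0: "s0 \<in> sphere 0 1" "\<And>y. y \<in> sphere 0 1 \<Longrightarrow> g y \<le> g s0"
    using continuous_attains_sup[of "sphere (0::'e) 1" g] by auto
  have s0n: "s0 \<noteq> 0" using s0(1) by auto
  define s where "s = n s0"
  have s: "s \<noteq> 0" "F s = r" unfolding s_def using n0[OF s0n] Fn[OF s0n] by auto
  have gs: "g s = g s0" "g s = f s" unfolding g_def using n_fix[OF s] by (auto simp: s_def)
  have max: "g y \<le> g s" if "y \<noteq> 0" for y
  proof -
    have "g y = g ((1 / norm y) *\<^sub>R y)" unfolding g_def using nn[OF that, of "1 / norm y"] that by simp
    also have "\<dots> \<le> g s0" by (rule s0(2)) (simp add: that)
    finally show ?thesis using gs by simp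
  qed
  have "(\<lambda>w. f' (n s) ((r / F s) *\<^sub>R w - (r * F' s w / (F s)\<^sup>2) *\<^sub>R s)) = (\<lambda>w. 0)"
    by (rule differential_zero_maxmin[of s "- {0}", OF _ _ dg[OF s(1)]]) (use s max in auto)
  then have "f' s w = 0" if "F' s w = 0" for w
    using that n_fix[OF s] s r by (auto dest: fun_cong[where x = w])
  moreover have "f y \<le> f s" if "y \<noteq> 0" "F y = r" for y
    using max[OF that(1)] n_fix[OF that] gs by (simp add: g_def)
  ultimately show thesis using that s by blast
qed

section \<open>The fibres: Berwald frames on a punctured plane\<close>

definition det2 :: "real^2 \<Rightarrow> real^2 \<Rightarrow> real" where
  "det2 y w = y $ 1 * w $ 2 - y $ 2 * w $ 1"

lemma bounded_bilinear_det2: "bounded_bilinear det2"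
  unfolding bilinear_conv_bounded_bilinear[symmetric] bilinear_def
  by (auto intro!: linearI simp: det2_def algebra_simps)

interpretation det2: bounded_bilinear det2 by (rule bounded_bilinear_det2)

lemmas has_derivative_det2 [derivative_intros] = det2.FDERIV

lemma det2_same [simp]: "det2 y y = 0" by (simp add: det2_def)

lemma det2_swap: "det2 w y = - det2 y w" by (simp add: det2_def)

lemma det2_cramer: "det2 y v *\<^sub>R w = det2 w v *\<^sub>R y + det2 y w *\<^sub>R v"
  by (simp add: vec_eq_iff forall_2 det2_def algebra_simps)

text \<open>The vertical part of a Berwald frame on one fibre, as seen from the fibre alone: \<open>v\<close> represents
  \<open>V\<close>, the last two equations are \<open>C(v) = v\<close> and \<open>V(v) = -y - I v\<close>.\<close>

locale berwald_plane =
  fixes F I :: "real^2 \<Rightarrow> real" and v :: "real^2 \<Rightarrow> real^2"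
    and F' :: "real^2 \<Rightarrow> real^2 \<Rightarrow> real" and v' :: "real^2 \<Rightarrow> real^2 \<Rightarrow> real^2"
  assumes F_pos: "y \<noteq> 0 \<Longrightarrow> F y > 0"
    and F_homogeneous: "y \<noteq> 0 \<Longrightarrow> t > 0 \<Longrightarrow> F (t *\<^sub>R y) = t * F y"
    and F_deriv: "y \<noteq> 0 \<Longrightarrow> (F has_derivative F' y) (at y)"
    and v_deriv: "y \<noteq> 0 \<Longrightarrow> (v has_derivative v' y) (at y)"
    and F'_v: "y \<noteq> 0 \<Longrightarrow> F' y (v y) = 0"
    and v'_radial: "y \<noteq> 0 \<Longrightarrow> v' y y = v y"
    and v'_v: "y \<noteq> 0 \<Longrightarrow> v' y (v y) = - y - I y *\<^sub>R v y"
begin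

lemma F'_linear: "y \<noteq> 0 \<Longrightarrow> linear (F' y)"
  using F_deriv has_derivative_linear by blast

lemma v'_linear: "y \<noteq> 0 \<Longrightarrow> linear (v' y)"
  using v_deriv has_derivative_linear by blast

text \<open>Euler's relation for the homogeneous function \<open>F\<close>.\<close>

lemma F'_radial:
  assumes "y \<noteq> 0"
  shows "F' y y = F y"
proof -
  have "((\<lambda>t. F (t *\<^sub>R y)) has_derivative (\<lambda>h. F' y (h *\<^sub>R y))) (at 1)"
  proof (rule has_derivative_compose[of "\<lambda>t. t *\<^sub>R y", where x = 1])
    show "((\<lambda>t. t *\<^sub>R y) has_derivative (\<lambda>h. h *\<^sub>R y)) (at 1)"
      by (auto intro!: derivative_eq_intros)
    show "(F has_derivative F' y) (at (1 *\<^sub>R y))" using F_deriv[OF assms] by simp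
  qed
  moreover have "((\<lambda>t. F (t *\<^sub>R y)) has_derivative (\<lambda>h. h * F y)) (at 1)"
    by (rule has_derivative_transform_within_open[of "\<lambda>t. t * F y" _ _ UNIV "{0<..}"])
      (auto intro!: derivative_eq_intros simp: F_homogeneous[OF assms])
  ultimately have "(\<lambda>h. F' y (h *\<^sub>R y)) = (\<lambda>h. h * F y)"
    by (rule has_derivative_unique)
  from fun_cong[OF this, of 1] show ?thesis by simp
qed

definition area :: "real^2 \<Rightarrow> real" where "area y = det2 y (v y)"

lemma area_deriv:
  assumes "y \<noteq> 0"
  shows "(area has_derivative (\<lambda>w. det2 y (v' y w) + det2 w (v y))) (at y)"
  unfolding area_def[abs_def] by (intro derivative_intros v_deriv assms)

text \<open>If \<open>v\<close> were a multiple of \<open>y\<close>, then \<open>V(F) = 0\<close> and Euler's relation would force \<open>v = 0\<close>, against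
  \<open>V(v) = -y - I v\<close>.\<close>

lemma area_nonzero:
  assumes y: "y \<noteq> 0"
  shows "area y \<noteq> 0"
proof
  assume 0: "area y = 0"
  obtain k where k: "v y = k *\<^sub>R y"
  proof (cases "y $ 1 = 0")
    case True
    then have "y $ 2 \<noteq> 0" using y by (auto simp: vec_eq_iff forall_2)
    then show ?thesis using 0 True
      by (intro that[of "v y $ 2 / y $ 2"]) (auto simp: vec_eq_iff forall_2 area_def det2_def)
  next
    case False
    then show ?thesis using 0
      by (intro that[of "v y $ 1 / y $ 1"]) (auto simp: vec_eq_iff forall_2 area_def det2_def field_simps)
  qed
  have "k * F y = 0" using F'_v[OF y] F'_radial[OF y] F'_linear[OF y] by (simp add: k linear_cmul)
  then have "v y = 0" using F_pos[OF y] k by auto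
  with v'_v[OF y] v'_linear[OF y] y show False by (simp add: linear_0)
qed

lemma linear_zero_on_frame:
  fixes g :: "real^2 \<Rightarrow> 'b::real_vector"
  assumes y: "y \<noteq> 0" and g: "linear g" "g y = 0" "g (v y) = 0"
  shows "g w = 0"
proof -
  have "area y *\<^sub>R g w = g (area y *\<^sub>R w)" using g by (simp add: linear_cmul)
  also have "\<dots> = 0" unfolding area_def det2_cramer[of y "v y" w]
    using g by (simp add: linear_add linear_cmul)
  finally show ?thesis using area_nonzero[OF y] by simp
qed

text \<open>The sign \<open>k\<close> in the proof treats the maximum and the minimum of \<open>I D\<close> on the indicatrix through \<open>y\<close> at
  once. At either extremum \<open>0 = V(I D) = -I\<^sup>2 D\<close>, so both extremal values of \<open>I D\<close> are \<open>0\<close>.\<close>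

theorem main_scalar_zero_if_invariant:
  assumes I: "\<And>y. y \<noteq> 0 \<Longrightarrow> (I has_derivative I' y) (at y)"
    and inv: "\<And>y. y \<noteq> 0 \<Longrightarrow> I' y (v y) = 0"
    and y: "y \<noteq> 0"
  shows "I y = 0"
proof -
  have bound: "k * (I y * area y) \<le> 0" if "\<bar>k\<bar> = 1" for k
  proof -
    have d: "((\<lambda>y. k * (I y * area y)) has_derivative
        (\<lambda>w. k * (I y * (det2 y (v' y w) + det2 w (v y)) + I' y w * area y))) (at y)" if "y \<noteq> 0" for y
      by (intro has_derivative_mult_right has_derivative_mult I area_deriv that)
    obtain s where s: "s \<noteq> 0" "F s = F y"
      and max: "\<And>z. z \<noteq> 0 \<Longrightarrow> F z = F y \<Longrightarrow> k * (I z * area z) \<le> k * (I s * area s)"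
      and crit: "\<And>w. F' s w = 0 \<Longrightarrow>
        k * (I s * (det2 s (v' s w) + det2 w (v s)) + I' s w * area s) = 0"
      using constrained_maximum[OF F_pos F_homogeneous F_deriv d F_pos[OF y]] by blast
    have "k * ((I s)\<^sup>2 * area s) = 0"
      using crit[OF F'_v[OF s(1)]] inv[OF s(1)]
      by (simp add: v'_v[OF s(1)] area_def det2.minus_right det2.diff_right det2.scaleR_right
          power2_eq_square)
    then have "I s = 0" using area_nonzero[OF s(1)] that by auto
    with max[OF y] show ?thesis by simp
  qed
  have "I y * area y = 0" using bound[of 1] bound[of "-1"] by simp
  then show ?thesis using area_nonzero[OF y] by simp
qed

text \<open>For fixed vectors \<open>w\<close> and \<open>w'\<close>, \<open>Q w w' y\<close> is the inner product of \<open>w\<close> and \<open>w'\<close> for which \<open>y\<close> and \<open>v(y)\<close>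
  are orthogonal of length \<open>F(y)\<close>, computed from Cramer's rule. It is homogeneous of degree \<open>0\<close>
  in \<open>y\<close>; along \<open>V\<close>, the frame \<open>(y, v)\<close> has the derivative \<open>(v, -y)\<close>, an infinitesimal rotation, which changes
  neither the area nor the form. So \<open>Q w w'\<close> is constant on the connected punctured plane.\<close>

theorem quadratic_if_main_scalar_zero:
  assumes I0: "\<And>y. y \<noteq> 0 \<Longrightarrow> I y = 0"
  shows "\<exists>b. bilinear b \<and> (\<forall>y. y \<noteq> 0 \<longrightarrow> (F y)\<^sup>2 = b y y)"
proof -
  define Q where "Q w w' y = (F y / area y) * (F y / area y) *
      (det2 w (v y) * det2 w' (v y) + det2 y w * det2 y w')" for w w' y
  have dQ: "(Q w w' has_derivative (\<lambda>h. 0)) (at y)" if y: "y \<noteq> 0" for w w' y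
  proof -
    let ?r = "F y / area y"
    let ?r' = "\<lambda>h. (F' y h * area y - F y * (det2 y (v' y h) + det2 h (v y))) / (area y * area y)"
    let ?n = "\<lambda>y. det2 w (v y) * det2 w' (v y) + det2 y w * det2 y w'"
    let ?n' = "\<lambda>h. (det2 w (v y) * det2 w' (v' y h) + det2 w (v' y h) * det2 w' (v y))
        + (det2 y w * det2 h w' + det2 h w * det2 y w')"
    let ?Q' = "\<lambda>h. ?r * ?r * ?n' h + (?r * ?r' h + ?r' h * ?r) * ?n y"
    have n: "(?n has_derivative ?n') (at y)"
      by (intro has_derivative_add has_derivative_mult has_derivative_ident v_deriv y
          bounded_linear.has_derivative[OF det2.bounded_linear_right]
          bounded_linear.has_derivative[OF det2.bounded_linear_left])
    have d: "(Q w w' has_derivative ?Q') (at y)"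
      unfolding Q_def[abs_def]
      by (intro has_derivative_mult has_derivative_divide' F_deriv area_deriv n y area_nonzero)
    have "?Q' h = 0" for h
    proof (rule linear_zero_on_frame[OF y has_derivative_linear[OF d]])
      have "det2 y (v' y y) + det2 y (v y) = 2 * area y"
        by (simp add: area_def v'_radial[OF y])
      then have r: "?r' y = - ?r"
        using area_nonzero[OF y] by (simp add: F'_radial[OF y] field_simps)
      have n: "?n' y = 2 * ?n y" by (simp add: v'_radial[OF y])
      show "?Q' y = 0" unfolding r n by simp
      have "det2 y (v' y (v y)) = 0"
        using I0[OF y] by (simp add: v'_v[OF y] det2.minus_right)
      then have r: "?r' (v y) = 0" by (simp add: F'_v[OF y])
      have n: "?n' (v y) = 0"
        using I0[OF y] det2_swap[of w] det2_swap[of w']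
        by (simp add: v'_v[OF y] det2.minus_right)
      show "?Q' (v y) = 0" unfolding r n by simp
    qed
    with d show ?thesis by simp
  qed
  define e :: "real^2" where "e = axis 1 1"
  have e: "e \<noteq> 0" by (simp add: e_def axis_eq_0_iff)
  have "connected (- {0 :: real^2})"
    by (rule connected_punctured_universe) simp
  then have const: "Q w w' y = Q w w' e" if "y \<noteq> 0" for w w' y
    using has_derivative_zero_unique_connected[of "- {0}" "Q w w'" y e] dQ that e by auto
  have "bilinear (\<lambda>w w'. c * (det2 w p * det2 w' p + det2 e w * det2 e w'))" for c p
    unfolding bilinear_def
    by (auto intro!: linearI simp: det2.add_left det2.add_right det2.scaleR_left det2.scaleR_right
        distrib_left distrib_right mult.left_commute)
  then have "bilinear (\<lambda>w w'. Q w w' e)" unfolding Q_def .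
  moreover have "(F y)\<^sup>2 = Q y y e" if y: "y \<noteq> 0" for y
  proof -
    have "Q y y y = (F y)\<^sup>2"
      using area_nonzero[OF y] by (simp add: Q_def power2_eq_square flip: area_def)
    then show ?thesis using const[OF y] by simp
  qed
  ultimately show ?thesis by blast
qed

text \<open>With \<open>B\<close> the symmetric form such that \<open>B(y, y) = 2 F\<^sup>2\<close>, differentiating \<open>B(y, y)\<close> along \<open>V\<close>
  gives \<open>B(y, v) = 0\<close>, differentiating this gives \<open>B(v, v) = B(y, y)\<close>, and differentiating this gives
  \<open>I B(v, v) = 0\<close>.\<close>

theorem main_scalar_zero_if_quadratic:
  assumes b: "bilinear b" and Fb: "\<And>y. y \<noteq> 0 \<Longrightarrow> (F y)\<^sup>2 = b y y"
    and y: "y \<noteq> 0"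
  shows "I y = 0"
proof -
  define B where "B x z = b x z + b z x" for x z
  have "bilinear B"
    using b unfolding B_def bilinear_def by (auto intro!: linear_compose_add)
  then interpret B: bounded_bilinear B by (simp add: bilinear_conv_bounded_bilinear)
  have B_sym: "B x z = B z x" for x z by (simp add: B_def)
  have BF: "B x x = 2 * (F x)\<^sup>2" if "x \<noteq> 0" for x using Fb[OF that] by (simp add: B_def)
  have deriv_eq: "D = D'" if "x \<noteq> 0" "(f has_derivative D) (at x)" "(g has_derivative D') (at x)"
    "\<And>z. z \<noteq> 0 \<Longrightarrow> f z = g z" for f g :: "real^2 \<Rightarrow> real" and D D' x
  proof -
    have "(g has_derivative D) (at x)"
      by (rule has_derivative_transform_within_open[OF that(2), of "- {0}"]) (use that in auto)
    then show ?thesis using that(3) by (rule has_derivative_unique)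
  qed
  have orth: "B x (v x) = 0" if x: "x \<noteq> 0" for x
  proof -
    have "((\<lambda>x. B x x) has_derivative (\<lambda>h. B x h + B h x)) (at x)"
      by (intro B.FDERIV has_derivative_ident)
    moreover have "((\<lambda>x. 2 * (F x)\<^sup>2) has_derivative (\<lambda>h. 4 * F x * F' x h)) (at x)"
      by (auto intro!: derivative_eq_intros F_deriv x)
    ultimately have "(\<lambda>h. B x h + B h x) = (\<lambda>h. 4 * F x * F' x h)"
      by (rule deriv_eq[OF x]) (rule BF)
    from fun_cong[OF this, of "v x"] show ?thesis
      using F'_v[OF x] by (simp add: B_sym[of "v x"])
  qed
  have vv: "B (v x) (v x) = B x x" if x: "x \<noteq> 0" for x
  proof -
    have "((\<lambda>x. B x (v x)) has_derivative (\<lambda>h. B x (v' x h) + B h (v x))) (at x)"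
      by (intro B.FDERIV has_derivative_ident v_deriv x)
    then have "(\<lambda>h. B x (v' x h) + B h (v x)) = (\<lambda>h. 0)"
      by (rule deriv_eq[OF x _ has_derivative_const]) (rule orth)
    from fun_cong[OF this, of "v x"] show ?thesis
      using orth[OF x] by (simp add: v'_v[OF x] B.diff_right B.minus_right B.scaleR_right)
  qed
  have "((\<lambda>x. B (v x) (v x)) has_derivative (\<lambda>h. B (v y) (v' y h) + B (v' y h) (v y))) (at y)"
    by (intro B.FDERIV v_deriv y)
  moreover have "((\<lambda>x. B x x) has_derivative (\<lambda>h. B y h + B h y)) (at y)"
    by (intro B.FDERIV has_derivative_ident)
  ultimately have "(\<lambda>h. B (v y) (v' y h) + B (v' y h) (v y)) = (\<lambda>h. B y h + B h y)"
    by (rule deriv_eq[OF y]) (rule vv)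
  from fun_cong[OF this, of "v y"] have "I y * B (v y) (v y) = 0"
    using orth[OF y] B_sym[of "v y" y] B_sym[of "v' y (v y)" "v y"]
    by (simp add: v'_v[OF y] B.diff_right B.minus_right B.scaleR_right)
  then show ?thesis using vv[OF y] BF[OF y] F_pos[OF y] by simp
qed

end

section \<open>Vector fields in charts\<close>

text \<open>The part of the structure of a smooth manifold that calculus with vector fields uses. It is stated
  without reference to a topology on the points, since it is applied to a surface and to its slit tangent
  bundle.\<close>

locale differentiable_atlas =
  fixes B :: "('p, 'e::euclidean_space) chart set"
  assumes inj_chart: "c \<in> B \<Longrightarrow> inj_on (snd c) (fst c)"
    and open_overlap: "c \<in> B \<Longrightarrow> c' \<in> B \<Longrightarrow> open (snd c ` (fst c \<inter> fst c'))"
    and transition_differentiable: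
      "c \<in> B \<Longrightarrow> c' \<in> B \<Longrightarrow> p \<in> fst c \<inter> fst c' \<Longrightarrow> transition c c' differentiable (at (snd c p))"
begin

lemma chart_inv_chart [simp]: "c \<in> B \<Longrightarrow> p \<in> fst c \<Longrightarrow> chart_inv c (snd c p) = p"
  unfolding chart_inv_def by (rule inv_into_f_f[OF inj_chart])

lemma local_rep_chart [simp]: "c \<in> B \<Longrightarrow> p \<in> fst c \<Longrightarrow> local_rep c f (snd c p) = f p"
  by (simp add: local_rep_def)

lemma transition_chart [simp]: "c \<in> B \<Longrightarrow> p \<in> fst c \<Longrightarrow> transition c c' (snd c p) = snd c' p"
  by (simp add: transition_def)

lemma open_chart_image: "c \<in> B \<Longrightarrow> open (snd c ` fst c)"
  using open_overlap[of c c] by simp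

lemma in_carrier: "c \<in> B \<Longrightarrow> p \<in> fst c \<Longrightarrow> p \<in> carrier B"
  by (auto simp: carrier_def)

lemma chart_around: "p \<in> carrier B \<Longrightarrow> (SOME c. c \<in> B \<and> p \<in> fst c) \<in> B \<and> p \<in> fst (SOME c. c \<in> B \<and> p \<in> fst c)"
  by (rule someI_ex) (auto simp: carrier_def)

lemma derivative_transition:
  assumes "c \<in> B" "c' \<in> B" "p \<in> fst c" "p \<in> fst c'"
    and f: "local_rep c' f differentiable (at (snd c' p))"
  shows "(local_rep c f has_derivative
      (\<lambda>w. frechet_derivative (local_rep c' f) (at (snd c' p))
            (frechet_derivative (transition c c') (at (snd c p)) w))) (at (snd c p))"
proof -
  have t: "(transition c c' has_derivative frechet_derivative (transition c c') (at (snd c p))) (at (snd c p))"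
    using transition_differentiable[of c c' p] assms by (simp flip: frechet_derivative_works)
  have d: "(local_rep c' f has_derivative frechet_derivative (local_rep c' f) (at (snd c' p)))
      (at (transition c c' (snd c p)))"
    using f assms by (simp flip: frechet_derivative_works)
  show ?thesis
    by (rule has_derivative_transform_within_open[OF has_derivative_compose[OF t d] open_overlap[of c c']])
      (use assms in auto)
qed

lemma smooth_function_differentiable:
  assumes "smooth_function B f" "c \<in> B" "p \<in> fst c"
  shows "local_rep c f differentiable (at (snd c p))"
  using assms smooth_map_on_differentiable by (fastforce simp: smooth_function_def)

lemma tangent_vector_transition:
  assumes "w \<in> tangent_space B p" "c \<in> B" "c' \<in> B" "p \<in> fst c" "p \<in> fst c'"
  shows "w c' = frechet_derivative (transition c c') (at (snd c p)) (w c)"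
  using assms unfolding tangent_space_def by blast

text \<open>Under a change of charts the derivative of the local representative is composed with the derivative of the
  transition map, which is the transformation law of tangent vectors.\<close>

lemma differential_in_chart:
  assumes c: "c \<in> B" "p \<in> fst c" and f: "smooth_function B f" and w: "w \<in> tangent_space B p"
  shows "differential B f p w = frechet_derivative (local_rep c f) (at (snd c p)) (w c)"
proof -
  define c0 where "c0 = (SOME c. c \<in> B \<and> p \<in> fst c)"
  have c0: "c0 \<in> B" "p \<in> fst c0"
    using chart_around[OF in_carrier[OF c]] by (auto simp: c0_def)
  have "local_rep c0 f differentiable (at (snd c0 p))"
    using smooth_function_differentiable[OF f c0] .
  then have "frechet_derivative (local_rep c f) (at (snd c p)) (w c)
    = frechet_derivative (local_rep c0 f) (at (snd c0 p)) (frechet_derivative (transition c c0) (at (snd c p)) (w c))"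
    using fun_cong[OF frechet_derivative_at[OF derivative_transition[OF c(1) c0(1) c(2) c0(2)]], of f "w c"] by simp
  also have "frechet_derivative (transition c c0) (at (snd c p)) (w c) = w c0"
    by (rule tangent_vector_transition[OF w c(1) c0(1) c(2) c0(2), symmetric])
  finally show ?thesis by (simp add: differential_def Let_def flip: c0_def)
qed

lemma vf_apply_cong:
  assumes "\<And>q. q \<in> carrier B \<Longrightarrow> f q = g q" "p \<in> carrier B"
  shows "vf_apply B Y f p = vf_apply B Y g p"
proof -
  define c where "c = (SOME c. c \<in> B \<and> p \<in> fst c)"
  have c: "c \<in> B" "p \<in> fst c" using chart_around[OF assms(2)] by (auto simp: c_def)
  have "frechet_derivative (local_rep c f) (at (snd c p)) = frechet_derivative (local_rep c g) (at (snd c p))"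
    by (rule frechet_derivative_cong_open[OF open_chart_image[OF c(1)]])
      (use c assms(1) in_carrier[OF c(1)] in auto)
  then show ?thesis by (simp add: vf_apply_def differential_def Let_def flip: c_def)
qed

lemma vf_apply_zero:
  assumes "\<And>q. q \<in> carrier B \<Longrightarrow> f q = 0" "p \<in> carrier B"
  shows "vf_apply B Y f p = 0"
  using vf_apply_cong[of f "\<lambda>_. 0" p Y] assms
  by (simp add: vf_apply_def differential_def Let_def local_rep_def)

lemma smooth_vfield_differentiable:
  assumes "smooth_vfield B Y" "c \<in> B" "p \<in> fst c"
  shows "local_rep c (\<lambda>q. Y q c) differentiable (at (snd c p))"
  using assms smooth_map_on_differentiable by (fastforce simp: smooth_vfield_def)

text \<open>The function \<open>Z(f)\<close> is defined pointwise by a choice of chart at each point; by independence of the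
  chart it is near \<open>p\<close> the directional derivative in one fixed chart, where the commutator of
  directional derivatives applies.\<close>

theorem vf_apply_lie_bracket:
  assumes Y: "smooth_vfield B Y" and Z: "smooth_vfield B Z" and f: "smooth_function B f"
    and p: "p \<in> carrier B"
  shows "vf_apply B Y (vf_apply B Z f) p - vf_apply B Z (vf_apply B Y f) p
       = differential B f p (lie_bracket B Y Z p)"
proof -
  define c where "c = (SOME c. c \<in> B \<and> p \<in> fst c)"
  have c: "c \<in> B" "p \<in> fst c" using chart_around[OF p] by (auto simp: c_def)
  let ?z = "snd c p" and ?W = "snd c ` fst c"
  have rep: "frechet_derivative (local_rep c (vf_apply B X f)) (at ?z)
      = frechet_derivative (\<lambda>x. frechet_derivative (local_rep c f) (at x) (local_rep c (\<lambda>q. X q c) x)) (at ?z)"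
    if X: "smooth_vfield B X" for X
  proof (rule frechet_derivative_cong_open[OF open_chart_image[OF c(1)]])
    fix x assume "x \<in> ?W"
    then obtain q where q: "q \<in> fst c" "x = snd c q" by auto
    then have "X q \<in> tangent_space B q"
      using X in_carrier[OF c(1)] by (auto simp: smooth_vfield_def)
    then show "local_rep c (vf_apply B X f) x
        = frechet_derivative (local_rep c f) (at x) (local_rep c (\<lambda>q. X q c) x)"
      using q c(1) by (simp add: vf_apply_def differential_in_chart[OF c(1) q(1) f])
  qed (use c in auto)
  have "smooth_map_on ?W (local_rep c f)" using f c by (auto simp: smooth_function_def)
  from commutator_of_directional_derivatives[OF open_chart_image[OF c(1)] _ this
      smooth_vfield_differentiable[OF Y c] smooth_vfield_differentiable[OF Z c]]
  show ?thesis
    using c rep[OF Y] rep[OF Z]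
    by (simp add: vf_apply_def[of B Y "vf_apply B Z f"] vf_apply_def[of B Z "vf_apply B Y f"]
        differential_def Let_def lie_bracket_def flip: c_def)
qed

lemma derivative_transition_linear:
  assumes "c \<in> B" "c' \<in> B" "p \<in> fst c" "p \<in> fst c'"
  shows "linear (frechet_derivative (transition c c') (at (snd c p)))"
  using transition_differentiable[of c c' p] assms by (auto intro: linear_frechet_derivative)

lemma tangent_vector_eqI:
  assumes "w \<in> tangent_space B p" "w' \<in> tangent_space B p" "c \<in> B" "p \<in> fst c" "w c = w' c"
  shows "w = w'"
proof
  fix c'
  show "w c' = w' c'"
  proof (cases "c' \<in> B \<and> p \<in> fst c'")
    case True
    then show ?thesis
      by (metis assms tangent_vector_transition)
  next
    case False
    then show ?thesis using assms(1,2) unfolding tangent_space_def by (metis (mono_tags, lifting) mem_Collect_eq)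
  qed
qed

lemma zero_tangent_vector: "(\<lambda>c. 0) \<in> tangent_space B p"
  using derivative_transition_linear by (auto simp: tangent_space_def linear_0)

text \<open>A prescribed component in one chart is transported to the others by the transition maps; the chain rule
  for transition maps makes the resulting family a tangent vector.\<close>

lemma tangent_vector_exists:
  assumes c: "c \<in> B" "p \<in> fst c"
  obtains w where "w \<in> tangent_space B p" "w c = e"
proof -
  define w where "w c' = (if c' \<in> B \<and> p \<in> fst c'
      then frechet_derivative (transition c c') (at (snd c p)) e else 0)" for c'
  have cocycle: "frechet_derivative (transition c c'') (at (snd c p)) e
      = frechet_derivative (transition c' c'') (at (snd c' p))
          (frechet_derivative (transition c c') (at (snd c p)) e)"
    if "c' \<in> B" "c'' \<in> B" "p \<in> fst c'" "p \<in> fst c''" for c' c''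
    using fun_cong[OF frechet_derivative_at[OF derivative_transition[OF c(1) that(1) c(2) that(3), of "snd c''"]], of e]
      transition_differentiable[of c' c'' p] that
    by (simp add: transition_def)
  have "w c'' = frechet_derivative (transition c' c'') (at (snd c' p)) (w c')"
    if "c' \<in> B" "c'' \<in> B" "p \<in> fst c'" "p \<in> fst c''" for c' c''
    using cocycle[OF that] that by (simp add: w_def)
  moreover have "w c' = 0" if "\<not> (c' \<in> B \<and> p \<in> fst c')" for c'
    using that unfolding w_def by (rule if_not_P)
  ultimately have "w \<in> tangent_space B p" unfolding tangent_space_def by blast
  moreover have "frechet_derivative (transition c c) (at (snd c p)) = frechet_derivative (\<lambda>x. x) (at (snd c p))"
    by (rule frechet_derivative_cong_open[OF open_chart_image[OF c(1)]]) (use c in auto)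
  then have "w c = e" using c by (simp add: w_def)
  ultimately show thesis by (rule that)
qed

end

lemma smooth_manifold_differentiable_atlas:
  assumes M: "smooth_manifold X A"
  shows "differentiable_atlas A"
proof
  fix c assume c: "c \<in> A"
  have h: "homeomorphic_map (subtopology X (fst c)) (top_of_set (snd c ` fst c)) (snd c)"
    and o: "openin X (fst c)" "open (snd c ` fst c)"
    using M c by (auto simp: smooth_manifold_def)
  show "inj_on (snd c) (fst c)"
    using homeomorphic_imp_injective_map[OF h] openin_subset[OF o(1)] by (simp add: Int_absorb1)
  fix c' assume c': "c' \<in> A"
  have "openin X (fst c')" using M c' by (auto simp: smooth_manifold_def)
  then have "openin (subtopology X (fst c)) (fst c \<inter> fst c')"
    by (simp add: openin_subtopology_Int2)
  then have "openin (top_of_set (snd c ` fst c)) (snd c ` (fst c \<inter> fst c'))"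
    using homeomorphic_imp_open_map[OF h] by (simp add: open_map_def)
  then show "open (snd c ` (fst c \<inter> fst c'))"
    using o(2) openin_open_trans by blast
  fix p assume "p \<in> fst c \<inter> fst c'"
  then show "transition c c' differentiable (at (snd c p))"
    using M c c' by (auto simp: smooth_manifold_def intro!: smooth_map_on_differentiable[of "snd c ` (fst c \<inter> fst c')"])
qed

section \<open>The slit tangent bundle\<close>

locale smooth_surface_atlas = differentiable_atlas A for A :: "('a, real^2) chart set" +
  assumes transition_smooth:
    "c \<in> A \<Longrightarrow> c' \<in> A \<Longrightarrow> smooth_map_on (snd c ` (fst c \<inter> fst c')) (transition c c')"
begin

lemma fst_induced_chart [simp]:
  "u \<in> fst (induced_chart A c) \<longleftrightarrow> u \<in> slit_bundle A \<and> fst u \<in> fst c"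
  by (auto simp: induced_chart_def)

lemma snd_induced_chart [simp]: "snd (induced_chart A c) u = (snd c (fst u), snd u c)"
  by (simp add: induced_chart_def split_beta)

lemma slit_bundle_iff:
  assumes "c \<in> A" "p \<in> fst c"
  shows "(p, w) \<in> slit_bundle A \<longleftrightarrow> w \<in> tangent_space A p \<and> w c \<noteq> 0"
proof -
  have "w c \<noteq> 0" if "w \<in> tangent_space A p" "w \<noteq> (\<lambda>c. 0)"
    using that tangent_vector_eqI[OF that(1) zero_tangent_vector assms] by auto
  then show ?thesis
    using in_carrier[OF assms] by (auto simp: slit_bundle_def tangent_bundle_def)
qed

lemma slit_bundle_base: "u \<in> slit_bundle A \<Longrightarrow> \<exists>c\<in>A. fst u \<in> fst c"
  by (fastforce simp: slit_bundle_def tangent_bundle_def carrier_def)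

lemma carrier_slit_atlas: "carrier (slit_atlas A) = slit_bundle A"
proof
  show "carrier (slit_atlas A) \<subseteq> slit_bundle A"
    by (auto simp: carrier_def slit_atlas_def simp del: split_paired_All)
  show "slit_bundle A \<subseteq> carrier (slit_atlas A)"
  proof
    fix u assume u: "u \<in> slit_bundle A"
    then obtain c where c: "c \<in> A" "fst u \<in> fst c" using slit_bundle_base by blast
    then have "induced_chart A c \<in> slit_atlas A" "u \<in> fst (induced_chart A c)"
      using u by (simp_all add: slit_atlas_def)
    then show "u \<in> carrier (slit_atlas A)" unfolding carrier_def by blast
  qed
qed

lemma slit_bundle_point:
  assumes "c \<in> A" "p \<in> fst c" "y \<noteq> 0"
  obtains w where "w \<in> tangent_space A p" "w c = y" "(p, w) \<in> slit_bundle A"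
proof -
  obtain w where "w \<in> tangent_space A p" "w c = y"
    using tangent_vector_exists[OF assms(1,2)] by blast
  then show thesis using that slit_bundle_iff[OF assms(1,2)] assms(3) by blast
qed

lemma induced_chart_image:
  assumes c: "c \<in> A"
  shows "snd (induced_chart A c) ` (fst (induced_chart A c) \<inter> fst (induced_chart A c'))
    = (snd c ` (fst c \<inter> fst c')) \<times> (- {0})"
proof (intro equalityI subsetI)
  fix z assume "z \<in> snd (induced_chart A c) ` (fst (induced_chart A c) \<inter> fst (induced_chart A c'))"
  then obtain u where u: "u \<in> slit_bundle A" "fst u \<in> fst c" "fst u \<in> fst c'" "z = (snd c (fst u), snd u c)"
    by auto
  then show "z \<in> (snd c ` (fst c \<inter> fst c')) \<times> (- {0})"
    using slit_bundle_iff[OF c u(2), of "snd u"] by auto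
next
  fix z assume "z \<in> (snd c ` (fst c \<inter> fst c')) \<times> (- {0 :: real^2})"
  then obtain p y where p: "p \<in> fst c" "p \<in> fst c'" "y \<noteq> 0" "z = (snd c p, y)" by auto
  then obtain w where w: "w c = y" "(p, w) \<in> slit_bundle A"
    using slit_bundle_point[OF c] by blast
  show "z \<in> snd (induced_chart A c) ` (fst (induced_chart A c) \<inter> fst (induced_chart A c'))"
    by (rule image_eqI[of _ _ "(p, w)"]) (use p w in auto)
qed

lemma inj_induced_chart:
  assumes c: "c \<in> A"
  shows "inj_on (snd (induced_chart A c)) (fst (induced_chart A c))"
proof (rule inj_onI)
  fix u u' assume u: "u \<in> fst (induced_chart A c)" "u' \<in> fst (induced_chart A c)"
    and eq: "snd (induced_chart A c) u = snd (induced_chart A c) u'"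
  have p: "fst u = fst u'"
    using inj_onD[OF inj_chart[OF c]] u eq by simp
  have "snd u = snd u'"
  proof (rule tangent_vector_eqI[OF _ _ c, of _ "fst u"])
    show "snd u \<in> tangent_space A (fst u)"
      using u slit_bundle_iff[OF c, of "fst u" "snd u"] by simp
    show "snd u' \<in> tangent_space A (fst u)"
      using u p slit_bundle_iff[OF c, of "fst u'" "snd u'"] by simp
  qed (use u eq in simp_all)
  with p show "u = u'" by (rule prod_eqI)
qed

lemma chart_inv_induced_chart:
  assumes "c \<in> A" "p \<in> fst c" "(p, w) \<in> slit_bundle A"
  shows "chart_inv (induced_chart A c) (snd c p, w c) = (p, w)"
  using inv_into_f_f[OF inj_induced_chart[OF assms(1)], of "(p, w)"] assms
  by (simp add: chart_inv_def)

text \<open>The second component is the transformation law of tangent vectors.\<close>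

lemma slit_transition:
  assumes c: "c \<in> A" "c' \<in> A" and p: "p \<in> fst c" "p \<in> fst c'" and y: "y \<noteq> 0"
  shows "transition (induced_chart A c) (induced_chart A c') (snd c p, y)
    = (transition c c' (snd c p), frechet_derivative (transition c c') (at (snd c p)) y)"
proof -
  obtain w where w: "w \<in> tangent_space A p" "w c = y" "(p, w) \<in> slit_bundle A"
    using slit_bundle_point[OF c(1) p(1) y] .
  then show ?thesis
    using chart_inv_induced_chart[OF c(1) p(1) w(3)] tangent_vector_transition[OF w(1) c p] c p
    by (simp add: transition_def[of "induced_chart A c"] local_rep_def)
qed

lemma has_derivative_slit_transition:
  assumes c: "c \<in> A" "c' \<in> A" and p: "p \<in> fst c" "p \<in> fst c'" and y: "y \<noteq> 0"
  defines "D \<equiv> \<lambda>x. frechet_derivative (transition c c') (at x)"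
  shows "(transition (induced_chart A c) (induced_chart A c') has_derivative
      (\<lambda>w. (D (snd c p) (fst w),
            frechet_derivative (\<lambda>x. D x y) (at (snd c p)) (fst w) + D (snd c p) (snd w))))
      (at (snd c p, y))"
proof -
  let ?O = "snd c ` (fst c \<inter> fst c')"
  let ?U = "?O \<times> (- {0 :: real^2})"
  have O: "open ?O" by (rule open_overlap[OF c])
  have U: "open ?U" by (intro open_Times O) auto
  have z: "(snd c p, y) \<in> ?U" using p y by auto
  have t: "(transition c c' has_derivative D (snd c p)) (at (fst (snd c p, y)))"
    unfolding D_def using transition_differentiable[OF c, of p] p by (simp flip: frechet_derivative_works)
  have "((\<lambda>z. D (fst z) (snd z)) has_derivative
      (\<lambda>w. frechet_derivative (\<lambda>x. D x (snd (snd c p, y))) (at (fst (snd c p, y))) (fst w)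
        + D (fst (snd c p, y)) (snd w))) (at (snd c p, y))"
    unfolding D_def
    by (rule has_derivative_directional_derivative[OF O transition_smooth[OF c] U z])
      (auto intro!: derivative_eq_intros)
  moreover have "((\<lambda>z. transition c c' (fst z)) has_derivative (\<lambda>w. D (snd c p) (fst w))) (at (snd c p, y))"
    by (rule has_derivative_compose[OF has_derivative_fst[OF has_derivative_ident] t])
  ultimately have "((\<lambda>z. (transition c c' (fst z), D (fst z) (snd z))) has_derivative
      (\<lambda>w. (D (snd c p) (fst w),
            frechet_derivative (\<lambda>x. D x y) (at (snd c p)) (fst w) + D (snd c p) (snd w))))
      (at (snd c p, y))"
    by (auto intro: has_derivative_Pair)
  moreover have "(transition c c' (fst z), D (fst z) (snd z))
      = transition (induced_chart A c) (induced_chart A c') z" if zU: "z \<in> ?U" for z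
  proof -
    have "fst z \<in> ?O" "snd z \<noteq> 0" using zU by (simp_all add: mem_Times_iff)
    then obtain q where "q \<in> fst c" "q \<in> fst c'" "fst z = snd c q" "snd z \<noteq> 0"
      by blast
    then show ?thesis
      using slit_transition[OF c, of q "snd z"] by (metis D_def prod.collapse)
  qed
  ultimately show ?thesis
    by (rule has_derivative_transform_within_open[OF _ U z])
qed

lemma slit_atlas_cases:
  assumes "C \<in> slit_atlas A"
  obtains c where "c \<in> A" "C = induced_chart A c"
  using assms by (auto simp: slit_atlas_def)

lemma differentiable_slit_atlas: "differentiable_atlas (slit_atlas A)"
proof
  fix C assume C: "C \<in> slit_atlas A"
  then obtain c where c: "c \<in> A" "C = induced_chart A c" by (rule slit_atlas_cases)
  show "inj_on (snd C) (fst C)" using inj_induced_chart[OF c(1)] c(2) by simp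
  fix C' assume "C' \<in> slit_atlas A"
  then obtain c' where c': "c' \<in> A" "C' = induced_chart A c'" by (rule slit_atlas_cases)
  show "open (snd C ` (fst C \<inter> fst C'))"
    unfolding c(2) c'(2) induced_chart_image[OF c(1)]
    by (intro open_Times open_overlap c c') auto
  fix u assume u: "u \<in> fst C \<inter> fst C'"
  then have "snd u c \<noteq> 0"
    using slit_bundle_iff[OF c(1), of "fst u" "snd u"] by (simp add: c c')
  then show "transition C C' differentiable (at (snd C u))"
    using has_derivative_slit_transition[OF c(1) c'(1), of "fst u" "snd u c"] u
    by (auto simp: c c' differentiable_def)
qed

sublocale slit: differentiable_atlas "slit_atlas A"
  by (rule differentiable_slit_atlas)

text \<open>The differential of a coordinate change \<open>(x, y) \<mapsto> (\<tau>(x), D\<tau>(x) y)\<close> maps \<open>(a, b)\<close> to a pair with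
  first component \<open>D\<tau>(x) a\<close>, and vertical vectors \<open>(0, e)\<close> to \<open>(0, D\<tau>(x) e)\<close>. Hence it commutes
  with \<open>(a, b) \<mapsto> (0, a)\<close>.\<close>

lemma almost_tangent_in_tangent_space:
  assumes w: "w \<in> tangent_space (slit_atlas A) u"
  shows "almost_tangent w \<in> tangent_space (slit_atlas A) u"
proof -
  have "almost_tangent w C' = frechet_derivative (transition C C') (at (snd C u)) (almost_tangent w C)"
    if C: "C \<in> slit_atlas A" "C' \<in> slit_atlas A" "u \<in> fst C \<inter> fst C'" for C C'
  proof -
    obtain c where c: "c \<in> A" "C = induced_chart A c" using C(1) by (rule slit_atlas_cases)
    obtain c' where c': "c' \<in> A" "C' = induced_chart A c'" using C(2) by (rule slit_atlas_cases)
    have u: "fst u \<in> fst c" "fst u \<in> fst c'" "snd u c \<noteq> 0"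
      using C slit_bundle_iff[OF c(1), of "fst u" "snd u"] by (auto simp: c c')
    let ?D = "\<lambda>x. frechet_derivative (transition c c') (at x)"
    let ?E = "frechet_derivative (\<lambda>x. ?D x (snd u c)) (at (snd c (fst u)))"
    have T: "frechet_derivative (transition C C') (at (snd C u))
        = (\<lambda>w. (?D (snd c (fst u)) (fst w), ?E (fst w) + ?D (snd c (fst u)) (snd w)))"
      using frechet_derivative_at[OF has_derivative_slit_transition[OF c(1) c'(1) u]]
      by (simp add: c c')
    have "linear ?E"
      using smooth_map_on_differentiable[OF smooth_map_on_derivative[OF transition_smooth[OF c(1) c'(1)]]] u
      by (intro linear_frechet_derivative) auto
    moreover have "linear (?D (snd c (fst u)))"
      by (rule derivative_transition_linear[OF c(1) c'(1) u(1,2)])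
    ultimately show ?thesis
      using slit.tangent_vector_transition[OF w C(1,2)] C(3)
      by (simp add: T almost_tangent_def linear_0)
  qed
  moreover have "almost_tangent w C = 0" if "\<not> (C \<in> slit_atlas A \<and> u \<in> fst C)" for C
  proof -
    have "w C = 0" using w that unfolding tangent_space_def by blast
    then show ?thesis by (simp add: almost_tangent_def zero_prod_def)
  qed
  ultimately show ?thesis unfolding tangent_space_def by blast
qed

end

lemma smooth_manifold_surface_atlas:
  assumes "smooth_manifold X A"
  shows "smooth_surface_atlas A"
proof -
  interpret differentiable_atlas A by (rule smooth_manifold_differentiable_atlas[OF assms])
  show ?thesis
    by unfold_locales (use assms in \<open>simp add: smooth_manifold_def\<close>)
qed

section \<open>Landsberg surfaces\<close>

lemma has_derivative_slice:
  assumes "f differentiable (at (x, y))"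
  shows "((\<lambda>y. f (x, y)) has_derivative (\<lambda>e. frechet_derivative f (at (x, y)) (0, e))) (at y)"
proof -
  have f: "(f has_derivative frechet_derivative f (at (x, y))) (at (x, y))"
    using assms by (simp flip: frechet_derivative_works)
  show ?thesis
    by (rule has_derivative_compose[of "\<lambda>y. (x, y)" "\<lambda>e. (0, e)", OF _ f])
      (auto intro!: has_derivative_Pair derivative_intros)
qed

locale berwald_framed_surface = smooth_surface_atlas A for A :: "('a, real^2) chart set" +
  fixes F K I L :: "'a tvec \<Rightarrow> real" and S H V :: "'a tvfield"
  assumes finsler: "finsler A F"
    and spray: "geodesic_spray A F S"
    and frame: "berwald_frame A F S K H V I L"
begin

lemma V_eq: "V = (\<lambda>u. almost_tangent (H u))"
  and smooth_H: "smooth_vfield (slit_atlas A) H"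
  and smooth_S: "smooth_vfield (slit_atlas A) S"
  and smooth_I: "smooth_function (slit_atlas A) I"
  and smooth_F: "smooth_function (slit_atlas A) F"
  using finsler spray frame
  by (auto simp: finsler_def geodesic_spray_def berwald_frame_def Let_def)

lemma frame_equations:
  assumes "u \<in> slit_bundle A"
  shows "lie_bracket (slit_atlas A) (liouville A) H u = H u"
    and "differential (slit_atlas A) F u (V u) = 0"
    and "lie_bracket (slit_atlas A) S H u = (\<lambda>c. (K u * (F u)\<^sup>2) *\<^sub>R V u c)"
    and "lie_bracket (slit_atlas A) H V u = (\<lambda>c. S u c + I u *\<^sub>R H u c + L u *\<^sub>R V u c)"
    and "vf_apply (slit_atlas A) S I u = L u"
  using frame assms by (auto simp: berwald_frame_def Let_def)

lemma F_pos: "u \<in> slit_bundle A \<Longrightarrow> F u > 0"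
  using finsler by (simp add: finsler_def)

lemma V_tangent: "u \<in> slit_bundle A \<Longrightarrow> V u \<in> tangent_space (slit_atlas A) u"
  unfolding V_eq using smooth_H
  by (intro almost_tangent_in_tangent_space) (simp add: smooth_vfield_def carrier_slit_atlas)

text \<open>In induced coordinates the base component of a bracket with a vertical field \<open>Y\<close> only involves the
  derivative of the other field along \<open>Y\<close>, because the base component of \<open>Y\<close> is zero throughout. Thus the
  base components of \<open>[C, H] = H\<close> and \<open>[H, V] = S + I H + L V\<close> contain only derivatives along the
  fibre: with \<open>v\<close> the base component of \<open>H\<close> they read \<open>C(v) = v\<close> and \<open>- V(v) = y + I v\<close>.\<close>

lemma berwald_frame_restricts_to_fibre:
  assumes c: "c \<in> A" and p: "p \<in> fst c"
  defines "C \<equiv> induced_chart A c" and "x \<equiv> snd c p"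
  defines "h \<equiv> local_rep C (\<lambda>u. H u C)"
  shows "berwald_plane (\<lambda>y. local_rep C F (x, y)) (\<lambda>y. local_rep C I (x, y)) (\<lambda>y. fst (h (x, y)))
    (\<lambda>y e. frechet_derivative (local_rep C F) (at (x, y)) (0, e))
    (\<lambda>y e. fst (frechet_derivative h (at (x, y)) (0, e)))"
proof -
  have C: "C \<in> slit_atlas A" using c by (simp add: C_def slit_atlas_def)
  have at_point: "local_rep C F (x, y) > 0 \<and> local_rep C F differentiable (at (x, y)) \<and>
      h differentiable (at (x, y)) \<and>
      frechet_derivative (local_rep C F) (at (x, y)) (0, fst (h (x, y))) = 0 \<and>
      fst (frechet_derivative h (at (x, y)) (0, y)) = fst (h (x, y)) \<and>
      fst (frechet_derivative h (at (x, y)) (0, fst (h (x, y))))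
        = - y - local_rep C I (x, y) *\<^sub>R fst (h (x, y))"
    if y: "y \<noteq> 0" for y
  proof -
    obtain w where w: "w \<in> tangent_space A p" "w c = y" "(p, w) \<in> slit_bundle A"
      using slit_bundle_point[OF c p y] .
    define u where "u = (p, w)"
    have u: "u \<in> slit_bundle A" "u \<in> fst C" and z: "snd C u = (x, y)"
      using w p by (auto simp: u_def C_def x_def)
    have rep: "local_rep C f (x, y) = f u" for f :: "_ \<Rightarrow> 'z"
      using slit.local_rep_chart[OF C u(2), of f] by (simp add: z)
    have h: "h (x, y) = H u C" by (simp add: h_def rep)
    have I: "local_rep C I (x, y) = I u" and F: "local_rep C F (x, y) = F u"
      using slit.local_rep_chart[OF C u(2)] by (simp_all flip: z)
    have dF: "local_rep C F differentiable (at (x, y))"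
      using slit.smooth_function_differentiable[OF smooth_F C u(2)] by (simp add: z)
    have dh: "h differentiable (at (x, y))"
      using slit.smooth_vfield_differentiable[OF smooth_H C u(2)] by (simp add: h_def z)
    have V: "V u C = (0, fst (h (x, y)))" by (simp add: V_eq h almost_tangent_def)
    have F_V: "frechet_derivative (local_rep C F) (at (x, y)) (0, fst (h (x, y))) = 0"
      using frame_equations(2)[OF u(1)] slit.differential_in_chart[OF C u(2) smooth_F V_tangent[OF u(1)]]
      by (simp add: z V)
    \<comment> \<open>The base component of \<open>[C, H] = H\<close>.\<close>
    have lv: "liouville A q C = (0, snd (snd C q))" if "q \<in> fst C" for q
      using C that by (simp add: liouville_def)
    have "((\<lambda>z. (0 :: real^2, snd z :: real^2)) has_derivative (\<lambda>w. (0, snd w))) (at (x, y))"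
      by (auto intro!: derivative_eq_intros)
    then have "(local_rep C (\<lambda>q. liouville A q C) has_derivative (\<lambda>w. (0, snd w))) (at (x, y))"
      by (rule has_derivative_transform_within_open[OF _ slit.open_chart_image[OF C]])
        (use u z C lv in \<open>auto simp del: split_paired_All intro: rev_image_eqI\<close>)
    then have "frechet_derivative (local_rep C (\<lambda>q. liouville A q C)) (at (x, y)) = (\<lambda>w. (0, snd w))"
      by (rule frechet_derivative_at[symmetric])
    then have radial: "fst (frechet_derivative h (at (x, y)) (0, y)) = fst (h (x, y))"
      using arg_cong[OF fun_cong[OF frame_equations(1)[OF u(1)], of C], of fst] C u(2) lv[OF u(2)]
      by (simp add: lie_bracket_def z h flip: h_def)
    \<comment> \<open>The base component of \<open>[H, V] = S + I H + L V\<close>, where that of \<open>S\<close> is \<open>y\<close> because \<open>J S = C\<close>.\<close>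
    have "local_rep C (\<lambda>q. V q C) = (\<lambda>z. (0, fst (h z)))"
      by (simp add: V_eq h_def local_rep_def almost_tangent_def)
    moreover have "((\<lambda>z. (0 :: real^2, fst (h z))) has_derivative
        (\<lambda>w. (0, fst (frechet_derivative h (at (x, y)) w)))) (at (x, y))"
      using dh unfolding frechet_derivative_works by (auto intro!: derivative_intros)
    ultimately have "frechet_derivative (local_rep C (\<lambda>q. V q C)) (at (x, y))
        = (\<lambda>w. (0, fst (frechet_derivative h (at (x, y)) w)))"
      by (simp add: frechet_derivative_at[symmetric])
    moreover have "almost_tangent (S u) C = liouville A u C"
      using spray u(1) by (simp add: geodesic_spray_def)
    then have "fst (S u C) = y"
      by (simp add: lv[OF u(2)] z almost_tangent_def)
    ultimately have "- fst (frechet_derivative h (at (x, y)) (0, fst (h (x, y)))) = y + I u *\<^sub>R fst (h (x, y))"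
      using arg_cong[OF fun_cong[OF frame_equations(4)[OF u(1)], of C], of fst] C u(2)
      by (simp add: lie_bracket_def z h V flip: h_def)
    then have "fst (frechet_derivative h (at (x, y)) (0, fst (h (x, y)))) = - (y + I u *\<^sub>R fst (h (x, y)))"
      by (metis minus_minus)
    with radial F_V dF dh u finsler show ?thesis by (simp add: I F finsler_def)
  qed
  show ?thesis
  proof
    fix y :: "real^2" and t :: real assume y: "y \<noteq> 0" and t: "t > 0"
    obtain w where w: "w \<in> tangent_space A p" "w c = y" "(p, w) \<in> slit_bundle A"
      using slit_bundle_point[OF c p y] .
    have w0: "t *\<^sub>R w c' = frechet_derivative (transition c c') (at (snd c p)) (t *\<^sub>R w c)"
      if "c' \<in> A" "p \<in> fst c'" for c'
      using tangent_vector_transition[OF w(1) c that(1) p that(2)]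
        derivative_transition_linear[OF c that(1) p that(2)] by (simp add: linear_cmul)
    \<comment> \<open>The point of the fibre with coordinate \<open>t y\<close> is \<open>t\<close> times the one with coordinate \<open>y\<close>, so that
      homogeneity on the tangent bundle is homogeneity in the coordinate.\<close>
    obtain tw where tw: "tw \<in> tangent_space A p" "tw c = t *\<^sub>R y" "(p, tw) \<in> slit_bundle A"
      using slit_bundle_point[OF c p, of "t *\<^sub>R y"] y t by auto
    have "tw = (\<lambda>c. t *\<^sub>R w c)"
    proof
      fix c'
      show "tw c' = t *\<^sub>R w c'"
      proof (cases "c' \<in> A \<and> p \<in> fst c'")
        case True
        then show ?thesis
          using tangent_vector_transition[OF tw(1) c _ p, of c'] w0[of c'] w(2) tw(2) by simp
      next
        case False
        then have "tw c' = 0" "w c' = 0" using w(1) tw(1) unfolding tangent_space_def by blast+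
        then show ?thesis by simp
      qed
    qed
    moreover have "F (p, \<lambda>c. t *\<^sub>R w c) = t * F (p, w)"
      using finsler w(1) t in_carrier[OF c p] by (auto simp: finsler_def tangent_bundle_def)
    ultimately show "local_rep C F (x, t *\<^sub>R y) = t * local_rep C F (x, y)"
      using chart_inv_induced_chart[OF c p w(3)] chart_inv_induced_chart[OF c p tw(3)] w(2) tw(2)
      by (simp add: local_rep_def C_def x_def)
  next
    fix y :: "real^2" assume "y \<noteq> 0"
    then show "((\<lambda>y. local_rep C F (x, y)) has_derivative
        (\<lambda>e. frechet_derivative (local_rep C F) (at (x, y)) (0, e))) (at y)"
      using at_point by (intro has_derivative_slice) blast
  qed (use at_point has_derivative_fst[OF has_derivative_slice] in auto)
qed

context
  fixes c p
  assumes c: "c \<in> A" "p \<in> fst c"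
begin

abbreviation C where "C \<equiv> induced_chart A c"

interpretation fibre: berwald_plane "\<lambda>y. local_rep C F (snd c p, y)" "\<lambda>y. local_rep C I (snd c p, y)"
  "\<lambda>y. fst (local_rep C (\<lambda>u. H u C) (snd c p, y))"
  "\<lambda>y e. frechet_derivative (local_rep C F) (at (snd c p, y)) (0, e)"
  "\<lambda>y e. fst (frechet_derivative (local_rep C (\<lambda>u. H u C)) (at (snd c p, y)) (0, e))"
  by (rule berwald_frame_restricts_to_fibre[OF c])

lemma local_rep_fibre: "(p, w) \<in> slit_bundle A \<Longrightarrow> local_rep C f (snd c p, w c) = f (p, w)"
  by (simp add: local_rep_def chart_inv_induced_chart[OF c])

lemma main_scalar_zero_on_fibre_if_invariant:
  assumes V_I: "\<And>u. u \<in> slit_bundle A \<Longrightarrow> vf_apply (slit_atlas A) V I u = 0"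
    and u: "(p, w) \<in> slit_bundle A"
  shows "I (p, w) = 0"
proof -
  have C: "C \<in> slit_atlas A" using c by (simp add: slit_atlas_def)
  have "local_rep C I differentiable (at (snd c p, y)) \<and>
      frechet_derivative (local_rep C I) (at (snd c p, y))
        (0, fst (local_rep C (\<lambda>u. H u C) (snd c p, y))) = 0" if y: "y \<noteq> 0" for y
  proof -
    obtain w where w: "w c = y" "(p, w) \<in> slit_bundle A" using slit_bundle_point[OF c y] by blast
    have u: "(p, w) \<in> fst C" using w c by simp
    show ?thesis
      using slit.smooth_function_differentiable[OF smooth_I C u] V_I[OF w(2)]
        slit.differential_in_chart[OF C u smooth_I V_tangent[OF w(2)]] 
        local_rep_fibre[OF w(2), of "\<lambda>u. H u C"] w(1)
      by (simp add: vf_apply_def V_eq almost_tangent_def)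
  qed
  then have "local_rep C I (snd c p, w c) = 0"
    using slit_bundle_iff[OF c] u
    by (intro fibre.main_scalar_zero_if_invariant[OF has_derivative_slice]) auto
  then show ?thesis by (simp add: local_rep_fibre[OF u])
qed

lemma quadratic_on_fibre_if_main_scalar_zero:
  assumes I0: "\<And>w. (p, w) \<in> slit_bundle A \<Longrightarrow> I (p, w) = 0"
  shows "\<exists>b. bilinear b \<and> (\<forall>v\<in>tangent_space A p. (F (p, v))\<^sup>2 = b (v c) (v c))"
proof -
  have "local_rep C I (snd c p, y) = 0" if y: "y \<noteq> 0" for y
  proof -
    obtain w where w: "w c = y" "(p, w) \<in> slit_bundle A" using slit_bundle_point[OF c y] by blast
    then show ?thesis using I0[OF w(2)] local_rep_fibre[OF w(2), of I] by simp
  qed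
  then obtain b where b: "bilinear b"
    and Fb: "\<And>y. y \<noteq> 0 \<Longrightarrow> (local_rep C F (snd c p, y))\<^sup>2 = b y y"
    using fibre.quadratic_if_main_scalar_zero by blast
  have "(F (p, v))\<^sup>2 = b (v c) (v c)" if v: "v \<in> tangent_space A p" for v
  proof (cases "v c = 0")
    case True
    then have "v = (\<lambda>c. 0)" by (intro tangent_vector_eqI[OF v zero_tangent_vector c])
    then show ?thesis
      using finsler in_carrier[OF c] b by (simp add: finsler_def bilinear_lzero)
  next
    case False
    then have "(p, v) \<in> slit_bundle A" using v slit_bundle_iff[OF c] by blast
    then show ?thesis using Fb[OF False] local_rep_fibre[of v F] by simp
  qed
  with b show ?thesis by blast
qed

lemma main_scalar_zero_on_fibre_if_quadratic:
  assumes b: "bilinear b" and Fb: "\<And>v. v \<in> tangent_space A p \<Longrightarrow> (F (p, v))\<^sup>2 = b (v c) (v c)"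
    and u: "(p, w) \<in> slit_bundle A"
  shows "I (p, w) = 0"
proof -
  have "(local_rep C F (snd c p, y))\<^sup>2 = b y y" if y: "y \<noteq> 0" for y
  proof -
    obtain v where v: "v \<in> tangent_space A p" "v c = y" "(p, v) \<in> slit_bundle A"
      using slit_bundle_point[OF c y] .
    then show ?thesis using Fb[OF v(1)] local_rep_fibre[OF v(3), of F] by simp
  qed
  moreover have "w c \<noteq> 0" using u slit_bundle_iff[OF c] by simp
  ultimately have "local_rep C I (snd c p, w c) = 0"
    by (intro fibre.main_scalar_zero_if_quadratic[OF b])
  then show ?thesis using local_rep_fibre[OF u, of I] by simp
qed

end

theorem main_scalar_zero_if_vertically_invariant:
  assumes "\<And>u. u \<in> slit_bundle A \<Longrightarrow> vf_apply (slit_atlas A) V I u = 0" and u: "u \<in> slit_bundle A"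
  shows "I u = 0"
proof -
  obtain c where "c \<in> A" "fst u \<in> fst c" using slit_bundle_base[OF u] by blast
  from main_scalar_zero_on_fibre_if_invariant[OF this assms(1), of "snd u"] show ?thesis
    using u by simp
qed

theorem riemannian_iff_main_scalar_zero: "riemannian A F \<longleftrightarrow> (\<forall>u\<in>slit_bundle A. I u = 0)"
proof
  assume R: "riemannian A F"
  show "\<forall>u\<in>slit_bundle A. I u = 0"
  proof
    fix u assume u: "u \<in> slit_bundle A"
    obtain c where c: "c \<in> A" "fst u \<in> fst c" using slit_bundle_base[OF u] by blast
    obtain b where "bilinear b"
      "\<And>v. v \<in> tangent_space A (fst u) \<Longrightarrow> (F (fst u, v))\<^sup>2 = b (v c) (v c)"
      using R c unfolding riemannian_def by blast
    from main_scalar_zero_on_fibre_if_quadratic[OF c this, of "snd u"] show "I u = 0"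
      using u by simp
  qed
next
  assume "\<forall>u\<in>slit_bundle A. I u = 0"
  then show "riemannian A F"
    unfolding riemannian_def using quadratic_on_fibre_if_main_scalar_zero by blast
qed

text \<open>Since \<open>L = S(I) = 0\<close> everywhere, the left-hand side is \<open>S(H(I)) = [S, H](I)\<close>.\<close>

theorem flow_derivative_of_H_main_scalar:
  assumes Lb: "landsberg A L" and u: "u \<in> slit_bundle A"
  shows "vf_apply (slit_atlas A) S
      (\<lambda>u. vf_apply (slit_atlas A) H I u + vf_apply (slit_atlas A) V L u) u
    = K u * (F u)\<^sup>2 * vf_apply (slit_atlas A) V I u"
    (is "vf_apply ?B S ?f u = _")
proof -
  have L0: "L q = 0" if "q \<in> carrier ?B" for q
    using Lb that by (simp add: landsberg_def carrier_slit_atlas)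
  have uB: "u \<in> carrier ?B" using u by (simp add: carrier_slit_atlas)
  have "vf_apply ?B S ?f u = vf_apply ?B S (vf_apply ?B H I) u"
    by (rule slit.vf_apply_cong[OF _ uB]) (simp add: slit.vf_apply_zero[OF L0])
  also have "\<dots> = vf_apply ?B S (vf_apply ?B H I) u - vf_apply ?B H (vf_apply ?B S I) u"
    using slit.vf_apply_zero[of "vf_apply ?B S I" u H] frame_equations(5) L0 uB
    by (simp add: carrier_slit_atlas)
  also have "\<dots> = differential ?B I u (lie_bracket ?B S H u)"
    by (rule slit.vf_apply_lie_bracket[OF smooth_S smooth_H smooth_I uB])
  also have "\<dots> = K u * (F u)\<^sup>2 * vf_apply ?B V I u"
  proof -
    let ?c = "SOME c. c \<in> ?B \<and> u \<in> fst c"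
    have "local_rep ?c I differentiable (at (snd ?c u))"
      using slit.smooth_function_differentiable[OF smooth_I] slit.chart_around[OF uB] by blast
    from linear_frechet_derivative[OF this] show ?thesis
      unfolding frame_equations(3)[OF u] by (simp add: vf_apply_def differential_def Let_def linear_cmul)
  qed
  finally show ?thesis .
qed

end

theorem theorem4p4:
  fixes X :: "'a topology" and A :: "('a, real^2) chart set"
    and F K I L :: "'a tvec \<Rightarrow> real" and S H V :: "'a tvfield"
  assumes "smooth_manifold X A"
    and "finsler A F"
    and "geodesic_spray A F S"
    and "flag_curvature A F S K"
    and "nonflat A K"
    and "berwald_frame A F S K H V I L"
    and "landsberg A L"
  shows "first_integral A S
           (\<lambda>u. vf_apply (slit_atlas A) H I u + vf_apply (slit_atlas A) V L u)
         \<longleftrightarrow> riemannian A F"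
proof -
  interpret smooth_surface_atlas A by (rule smooth_manifold_surface_atlas[OF assms(1)])
  interpret berwald_framed_surface A F K I L S H V
    by unfold_locales (rule assms)+
  let ?B = "slit_atlas A"
  have "first_integral A S (\<lambda>u. vf_apply ?B H I u + vf_apply ?B V L u)
      \<longleftrightarrow> (\<forall>u\<in>slit_bundle A. K u * (F u)\<^sup>2 * vf_apply ?B V I u = 0)"
    by (simp add: first_integral_def flow_derivative_of_H_main_scalar[OF assms(7)])
  also have "\<dots> \<longleftrightarrow> (\<forall>u\<in>slit_bundle A. vf_apply ?B V I u = 0)"
    using assms(5) F_pos by (fastforce simp: nonflat_def)
  also have "\<dots> \<longleftrightarrow> (\<forall>u\<in>slit_bundle A. I u = 0)"
    using main_scalar_zero_if_vertically_invariant slit.vf_apply_zero[of I _ V]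
    by (auto simp: carrier_slit_atlas)
  also have "\<dots> \<longleftrightarrow> riemannian A F"
    by (simp add: riemannian_iff_main_scalar_zero)
  finally show ?thesis .
qed

end
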